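(* Let $\beta\in\mathbb{Z}_{\ge 0}\alpha_0+\mathbb{Z}_{\geq 0}\alpha_1$ and let $\pi = \{\pi^1, \pi^\delta, \pi^0\} \in \Pi(\beta)$ be a root partition in type ${\tt A}_1^{(1)}$. Set ${\tt w}(\pi) = \max\{{\tt w}(\pi^{0}), \pi_1^\delta, {\tt w}(\pi^{1})\}$ (where $\pi^\delta_1=0$ if $\pi^\delta=\varnothing$). Then $\pi_{\lozenge} = \{\pi_\lozenge^1, \pi_\lozenge^\delta, \pi_\lozenge^0\}$ is given by $$\pi_\lozenge^1 = \mathrm{orth}^{{\tt w}(\pi)}(\pi^0),\qquad \pi_\lozenge^0 = \mathrm{orth}^{{\tt w}(\pi)}(\pi^1),$$ $$\pi_{\lozenge}^\delta = \begin{cases} ({\tt w}(\pi), \pi_1^\delta, \ldots, \pi_{p(\pi^\delta)}^\delta) &\text{if } {\tt w}(\pi)={\tt w}(\pi^{0}) = {\tt w}(\pi^{1}); \\ (\pi^\delta_2, \ldots, \pi^\delta_{p(\pi^\delta)}) & \text{if } {\tt w}(\pi) > {\tt w}(\pi^{0})\text{ and }{\tt w}(\pi)> {\tt w}(\pi^{1});\\ \pi^\delta & \text{otherwise}. \end{cases}$$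
   Context: Partitions are identified with Young diagrams (English convention). $p(\lambda)$ is the number of nonzero rows, $c_t(\lambda)$ the length of the $t$th column, $c(\lambda)$ the number of nonzero columns, $n_k(\lambda)$ the number of rows of length $k$. $\lambda$ is 2-regular if no two nonzero rows have equal length. Spar tableau $\mathrm{spar}(\lambda)$: traversing columns from right to left, and each column from bottom to top, label each box with the smallest positive integer which exceeds the labels of the boxes directly below and directly to the right (if any), and appears nowhere in the column immediately to the right. ${\tt w}(\lambda)$ is the label of the upper left box of $\mathrm{spar}(\lambda)$ (and $0$ if $\lambda=\varnothing$). $\mathrm{ord}(\lambda)$ is the unique 2-regular partition $\mu$ with $c_t(\mu)$ odd if and only if $t$ appears in the first column of $\mathrm{spar}(\lambda)$. For $w\ge{\tt w}(\lambda)$, $\mathrm{ext}^w(\lambda)$ is obtained from $\mathrm{ord}(\lambda)$ by adding a row of length $w$ at the top if $w>{\tt w}(\lambda)$, or by deleting the top row if $w={\tt w}(\lambda)$. For 2-regular $\mu$, $\mathrm{calc}(\mu)$ is the partition built as follows: the first column consists of boxes labeled by $\{t\in[1,c(\mu)]\mid c_t(\mu)\text{ odd}\}$, decreasing from top to bottom; then, for the second and later columns, left to right, and within each column top to bottom, place a box labeled with the largest positive integer strictly less than every entry directly above or directly to the left of the new box and appearing nowhere in the column immediately to the left; if no such integer exists, or there is no box immediately to the left, end this column and go to the next; halt when a column receives no boxes. For $w\geq {\tt w}(\lambda)$ set $\mathrm{orth}^w(\lambda)=\mathrm{calc}(\mathrm{ext}^w(\lambda))$. Roots: $\alpha_0,\alpha_1$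 are the simple roots, $\delta=\alpha_0+\alpha_1$, $\alpha_{1:k}=k\alpha_1+(k-1)\alpha_0$, $\alpha_{0:k}=(k-1)\alpha_1+k\alpha_0$ for $k\ge 1$. A root partition of $\theta\in\mathbb{Z}_{\geq0}\alpha_0+\mathbb{Z}_{\ge0}\alpha_1$ is a triple of partitions $\pi=\{\pi^1,\pi^\delta,\pi^0\}$ with $\theta=\sum_{k\geq 1} n_k(\pi^1)\alpha_{1:k}+|\pi^\delta|\delta+\sum_{k\geq 1} n_k(\pi^0)\alpha_{0:k}$; $\Pi(\theta)$ is the set of these. Affine MV polytopes: for $\pi,\phi\in\Pi(\theta)$ and $m\geq 1$ put $c_m^{\uparrow}=\sum_{k=1}^m k(n_{k+1}(\phi^0)-n_k(\pi^1))$, $c_m^{\rightarrow}=\sum_{k=1}^m k(n_{k+1}(\pi^1)-n_k(\phi^0))$, $c_m^{\downarrow}=\sum_{k=1}^m k(n_{k+1}(\pi^0)-n_k(\phi^1))$, $c_m^{\leftarrow}=\sum_{k=1}^m k(n_{k+1}(\phi^1)-n_k(\pi^0))$. The pair $(\pi|\phi)$ is an affine Mirković–Vilonen (MV) polytope if: (1) for every $m\ge1$, $0\in\{c_m^\uparrow,c_m^\rightarrow\}\subseteq\mathbb{Z}_{\le0}$ and $0\in\{c_m^\downarrow,c_m^\leftarrow\}\subseteq\mathbb{Z}_{\le0}$; and (2) $\pi^\delta_1\le p(\pi^1)+p(\phi^0)=p(\pi^0)+p(\phi^1)$, and $\phi^\delta$ equals $\pi^\delta$ if $|\pi^\delta|=|\phi^\delta|$,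 equals $(\pi^\delta_2,\pi^\delta_3,\ldots)$ if $|\pi^\delta|>|\phi^\delta|$, and equals $(p(\pi^1)+p(\phi^0),\pi^\delta_1,\pi^\delta_2,\ldots)$ if $|\pi^\delta|<|\phi^\delta|$. It is known (Baumann–Dunlap–Kamnitzer–Tingley) that for each $\pi\in\Pi(\theta)$ there is a unique $\pi_\lozenge\in\Pi(\theta)$ such that $(\pi|\pi_\lozenge)$ is an affine MV polytope. *)

theory Defs
  imports "HOL-Library.Product_Plus"
begin

section \<open>Partitions\<close>

text \<open>A partition is the weakly decreasing list of its nonzero rows, so that every
  partition is represented by exactly one list.\<close>

type_synonym partition = "nat list"

definition is_partition :: "partition \<Rightarrow> bool" where
  "is_partition lam \<longleftrightarrow> sorted_wrt (\<ge>) lam \<and> (\<forall>x \<in> set lam. 0 < x)"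

definition num_rows :: "partition \<Rightarrow> nat" where
  "num_rows lam = length lam"

definition col_len :: "partition \<Rightarrow> nat \<Rightarrow> nat" where
  "col_len lam t = card {r. r < length lam \<and> t \<le> lam ! r}"

definition num_cols :: "partition \<Rightarrow> nat" where
  "num_cols lam = card {t. 1 \<le> t \<and> 0 < col_len lam t}"

definition rows_of_length :: "partition \<Rightarrow> nat \<Rightarrow> nat" where
  "rows_of_length lam k = count_list lam k"

definition first_part :: "partition \<Rightarrow> nat" where
  "first_part lam = (case lam of [] \<Rightarrow> 0 | x # _ \<Rightarrow> x)"

definition two_regular :: "partition \<Rightarrow> bool" where
  "two_regular lam \<longleftrightarrow> is_partition lam \<and> distinct lam"

text \<open>The partition $(x, \lambda_1, \lambda_2, \ldots)$. A row of length $0$ is no row: the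
  partition $(0)$ is the empty partition.\<close>

definition add_top_row :: "nat \<Rightarrow> partition \<Rightarrow> partition" where
  "add_top_row x lam = (if x = 0 then lam else x # lam)"

section \<open>Spar tableaux\<close>

text \<open>Boxes are (row, column) pairs, counted from $0$ at the top left.\<close>

definition boxes :: "partition \<Rightarrow> (nat \<times> nat) set" where
  "boxes lam = {(r, c). r < length lam \<and> c < lam ! r}"

function spar :: "partition \<Rightarrow> nat \<Rightarrow> nat \<Rightarrow> nat" where
  "spar lam r c =
    (if (r, c) \<in> boxes lam then
       (LEAST x. 0 < x
          \<and> ((r + 1, c) \<in> boxes lam \<longrightarrow> spar lam (r + 1) c < x)
          \<and> ((r, c + 1) \<in> boxes lam \<longrightarrow> spar lam r (c + 1) < x)
          \<and> (\<forall>s. (s, c + 1) \<in> boxes lam \<longrightarrow> spar lam s (c + 1) \<noteq> x))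
     else 0)"
  by pat_completeness auto
termination
proof (relation "measures [\<lambda>(lam, r, c). sum_list lam - c, \<lambda>(lam, r, c). length lam - r]",
    goal_cases)
  case 1
  show ?case by simp
next
  case 2
  then show ?case by (auto simp: boxes_def)
next
  case (3 lam r c)
  then show ?case
    using member_le_sum_list[of "lam ! r" lam] by (auto simp: boxes_def)
next
  case (4 lam r c)
  then show ?case
    using member_le_sum_list[of "lam ! r" lam] by (auto simp: boxes_def)
qed

declare spar.simps [simp del]

definition spar_first_col :: "partition \<Rightarrow> nat set" where
  "spar_first_col lam = {spar lam r 0 | r. (r, 0) \<in> boxes lam}"

definition wt_label :: "partition \<Rightarrow> nat" where
  "wt_label lam = (if lam = [] then 0 else spar lam 0 0)"

definition ord_part :: "partition \<Rightarrow> partition" where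
  "ord_part lam = (THE mu. two_regular mu \<and>
     (\<forall>t\<ge>1. odd (col_len mu t) \<longleftrightarrow> t \<in> spar_first_col lam))"

text \<open>Only meaningful for \<open>w \<ge> wt_label lam\<close>.\<close>

definition ext_part :: "nat \<Rightarrow> partition \<Rightarrow> partition" where
  "ext_part w lam =
    (if w > wt_label lam then add_top_row w (ord_part lam) else tl (ord_part lam))"

section \<open>The partition calc\<close>

text \<open>Columns are lists of labels from top to bottom. In \<open>calc_fill P ls a\<close>, \<open>P\<close> is the set
  of all labels in the previous column, \<open>ls\<close> the labels of that column in the rows still to be
  filled, and \<open>a\<close> the label directly above the next box, if any.\<close>

fun calc_fill :: "nat set \<Rightarrow> nat list \<Rightarrow> nat option \<Rightarrow> nat list" where
  "calc_fill P [] a = []"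
| "calc_fill P (l # ls) a =
    (let C = {x \<in> {1..<l}. (\<forall>y \<in> set_option a. x < y) \<and> x \<notin> P}
     in if C = {} then [] else Max C # calc_fill P ls (Some (Max C)))"

definition calc_next_col :: "nat list \<Rightarrow> nat list" where
  "calc_next_col col = calc_fill (set col) col None"

lemma hd_calc_next_col_less: "calc_next_col col \<noteq> [] \<Longrightarrow> hd (calc_next_col col) < hd col"
proof (cases col)
  case (Cons l ls)
  assume ne: "calc_next_col col \<noteq> []"
  let ?C = "{x \<in> {1..<l}. x \<notin> set col}"
  from ne Cons have "?C \<noteq> {}" and hd: "hd (calc_next_col col) = Max ?C"
    by (auto simp: calc_next_col_def Let_def split: if_splits)
  then have "Max ?C \<in> ?C" by (intro Max_in) auto
  with hd Cons show ?thesis by simp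
qed (simp add: calc_next_col_def)

function calc_cols :: "nat list \<Rightarrow> nat list list" where
  "calc_cols col = (if col = [] then [] else col # calc_cols (calc_next_col col))"
  by pat_completeness auto
termination
proof (relation "measure (\<lambda>col. if col = [] then 0 else Suc (hd col))", goal_cases)
  case 1
  show ?case by simp
next
  case 2
  then show ?case by (auto dest: hd_calc_next_col_less)
qed

declare calc_cols.simps [simp del]

definition calc_first_col :: "partition \<Rightarrow> nat list" where
  "calc_first_col mu =
    rev (sorted_list_of_set {t \<in> {1..num_cols mu}. odd (col_len mu t)})"

text \<open>The \<open>r\<close>-th row of the shape has one box for each column with more than \<open>r\<close> boxes.\<close>

definition calc :: "partition \<Rightarrow> partition" where
  "calc mu =
    (let cols = calc_cols (calc_first_col mu)
     in map (\<lambda>r. length (filter (\<lambda>col. r < length col) cols))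
          [0..<length (calc_first_col mu)])"

definition orth :: "nat \<Rightarrow> partition \<Rightarrow> partition" where
  "orth w lam = calc (ext_part w lam)"

section \<open>Root partitions\<close>

text \<open>The pair \<open>(a, b)\<close> stands for $a\alpha_0 + b\alpha_1$.\<close>

type_synonym pos_cone = "nat \<times> nat"

definition scale :: "nat \<Rightarrow> pos_cone \<Rightarrow> pos_cone" where
  "scale n v = (n * fst v, n * snd v)"

definition alpha0 :: pos_cone where "alpha0 = (1, 0)"

definition alpha1 :: pos_cone where "alpha1 = (0, 1)"

definition delta :: pos_cone where "delta = alpha0 + alpha1"

definition alpha1_root :: "nat \<Rightarrow> pos_cone" where
  "alpha1_root k = scale k alpha1 + scale (k - 1) alpha0"

definition alpha0_root :: "nat \<Rightarrow> pos_cone" where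
  "alpha0_root k = scale (k - 1) alpha1 + scale k alpha0"

datatype partition_triple =
  Triple (part1: partition) (part_delta: partition) (part0: partition)

text \<open>The sums over all $k \ge 1$ are restricted to the \<open>k\<close> for which there are rows of
  length \<open>k\<close>.\<close>

definition weight :: "partition_triple \<Rightarrow> pos_cone" where
  "weight \<pi> =
     (\<Sum>k\<in>set (part1 \<pi>). scale (rows_of_length (part1 \<pi>) k) (alpha1_root k))
     + scale (sum_list (part_delta \<pi>)) delta
     + (\<Sum>k\<in>set (part0 \<pi>). scale (rows_of_length (part0 \<pi>) k) (alpha0_root k))"

definition root_partitions :: "pos_cone \<Rightarrow> partition_triple set" where
  "root_partitions \<theta> =
    {\<pi>. is_partition (part1 \<pi>) \<and> is_partition (part_delta \<pi>) \<and> is_partition (part0 \<pi>)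
        \<and> weight \<pi> = \<theta>}"

section \<open>Affine MV polytopes\<close>

definition shift_sum :: "nat \<Rightarrow> partition \<Rightarrow> partition \<Rightarrow> int" where
  "shift_sum m lam mu =
    (\<Sum>k=1..m. int k * (int (rows_of_length lam (k + 1)) - int (rows_of_length mu k)))"

definition c_up :: "partition_triple \<Rightarrow> partition_triple \<Rightarrow> nat \<Rightarrow> int" where
  "c_up \<pi> \<phi> m = shift_sum m (part0 \<phi>) (part1 \<pi>)"

definition c_right :: "partition_triple \<Rightarrow> partition_triple \<Rightarrow> nat \<Rightarrow> int" where
  "c_right \<pi> \<phi> m = shift_sum m (part1 \<pi>) (part0 \<phi>)"

definition c_down :: "partition_triple \<Rightarrow> partition_triple \<Rightarrow> nat \<Rightarrow> int" where
  "c_down \<pi> \<phi> m = shift_sum m (part0 \<pi>) (part1 \<phi>)"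

definition c_left :: "partition_triple \<Rightarrow> partition_triple \<Rightarrow> nat \<Rightarrow> int" where
  "c_left \<pi> \<phi> m = shift_sum m (part1 \<phi>) (part0 \<pi>)"

definition affine_MV :: "partition_triple \<Rightarrow> partition_triple \<Rightarrow> bool" where
  "affine_MV \<pi> \<phi> \<longleftrightarrow>
     (\<forall>m\<ge>1. 0 \<in> {c_up \<pi> \<phi> m, c_right \<pi> \<phi> m} \<and> {c_up \<pi> \<phi> m, c_right \<pi> \<phi> m} \<subseteq> {..0}
          \<and> 0 \<in> {c_down \<pi> \<phi> m, c_left \<pi> \<phi> m} \<and> {c_down \<pi> \<phi> m, c_left \<pi> \<phi> m} \<subseteq> {..0})
     \<and> first_part (part_delta \<pi>) \<le> num_rows (part1 \<pi>) + num_rows (part0 \<phi>)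
     \<and> num_rows (part1 \<pi>) + num_rows (part0 \<phi>) = num_rows (part0 \<pi>) + num_rows (part1 \<phi>)
     \<and> part_delta \<phi> =
         (if sum_list (part_delta \<pi>) = sum_list (part_delta \<phi>) then part_delta \<pi>
          else if sum_list (part_delta \<pi>) > sum_list (part_delta \<phi>) then tl (part_delta \<pi>)
          else add_top_row (num_rows (part1 \<pi>) + num_rows (part0 \<phi>)) (part_delta \<pi>))"

text \<open>The triple $\pi_\lozenge$; existence and uniqueness are a theorem of Baumann, Dunlap,
  Kamnitzer and Tingley.\<close>

definition lozenge :: "pos_cone \<Rightarrow> partition_triple \<Rightarrow> partition_triple" where
  "lozenge \<theta> \<pi> = (THE \<phi>. \<phi> \<in> root_partitions \<theta> \<and> affine_MV \<pi> \<phi>)"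

definition wt_triple :: "partition_triple \<Rightarrow> nat" where
  "wt_triple \<pi> = Max {wt_label (part0 \<pi>), first_part (part_delta \<pi>), wt_label (part1 \<pi>)}"

end

theory Submission
  imports Defs "HOL-Library.Multiset"
begin

text \<open>
  Strictly decreasing lists \<open>C\<close> of positive integers serve as coordinates on partitions: \<open>C\<close> is
  the first column of a filling built by \<open>calc\<close>, the filling has a shape, and its labels are the
  spar labels of that shape (\<open>spar_shape\<close>). Every partition arises (\<open>partition_is_shape\<close>). In these
  coordinates a partition is a finite set \<open>S\<close> of positive integers, \<open>wt_label\<close> is the largest
  element of \<open>S\<close>, and \<open>orth w\<close> replaces \<open>S\<close> by its complement in \<open>{1..w}\<close> (\<open>orth_shape\<close>). The
  theorem thus says that the conditions on \<open>c_up\<close> and \<open>c_right\<close> (and likewise on \<open>c_down\<close> and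
  \<open>c_left\<close>) pair partitions that belong to complementary subsets of an interval \<open>{1..w}\<close>.

  The step from one column of \<open>calc\<close> to the next is a time step of a box-ball system. The labels
  are balls on the positions \<open>1, 2, \<dots>\<close>; every ball, beginning with the rightmost, moves to a free
  position on its left, and the balls that find none leave at the left end. A row of length \<open>k\<close> is a
  ball that leaves in step \<open>k\<close>, so the row multiplicities form the sequence of fluxes through
  the left end. A further position inserted at the left end, occupied or not, acts on this sequence
  as a transducer with two states (\<open>transit_shift_col\<close>): the state records whether the new position
  is occupied, an empty position retains one of the arriving balls, and an occupied one
  lets all arriving balls pass and adds its own.

  The sign conditions on an MV polytope say that two multiplicity sequences are \<open>balanced\<close>. The
  heart of the proof is that two transducers that start in opposite states carry balanced pairs to
  balanced pairs (\<open>balanced_transit\<close>), and that, conversely, the transducers run backwards from a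
  balanced pair other than zero always end in opposite states and produce a balanced pair
  (\<open>balanced_transit_back\<close>). The reason is that the occupied times of the two transducers
  alternate: between an occupied time of one and the next occupied time of the other,
  balancedness forces one of the two excesses to vanish, and the other one absorbs the change.
  By induction on \<open>w\<close>, balanced pairs are exactly the flux sequences of complementary subsets of
  \<open>{1..w}\<close> (\<open>balanced_words\<close>, \<open>words_of_balanced\<close>), which yields both existence and uniqueness of
  the partner.

  What remains is a comparison of sizes. For large \<open>m\<close> one of the two excesses of a balanced pair is
  \<open>w\<close> and the other \<open>0\<close>; which one is \<open>w\<close> is decided by the membership of \<open>w\<close> in \<open>S\<close>
  (\<open>excess_words_limit\<close>), that is, by the equation \<open>w = wt_label\<close>. Together with the equality of
  weights this determines the difference of the sizes of the two \<open>\<delta>\<close>-parts, and hence which of the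
  three cases occurs.
\<close>

section \<open>Columns and shapes\<close>

definition column :: "nat list \<Rightarrow> bool" where
  "column C \<longleftrightarrow> sorted_wrt (>) C \<and> (\<forall>x\<in>set C. 0 < x)"

text \<open>The labels among which \<open>calc_fill\<close> chooses the largest.\<close>

definition fill_candidate :: "nat set \<Rightarrow> nat \<Rightarrow> nat option \<Rightarrow> nat \<Rightarrow> bool" where
  "fill_candidate P l a x \<longleftrightarrow> 0 < x \<and> x < l \<and> (\<forall>y\<in>set_option a. x < y) \<and> x \<notin> P"

lemma calc_fill_Cons_cases:
  obtains "calc_fill P (l # ls) a = []" "\<And>x. \<not> fill_candidate P l a x"
  | d where "calc_fill P (l # ls) a = d # calc_fill P ls (Some d)" "fill_candidate P l a d"
      "\<And>x. fill_candidate P l a x \<Longrightarrow> x \<le> d"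
proof -
  let ?C = "{x \<in> {1..<l}. (\<forall>y \<in> set_option a. x < y) \<and> x \<notin> P}"
  have C: "?C = {x. fill_candidate P l a x}" by (auto simp: fill_candidate_def)
  have fin: "finite ?C" by simp
  show ?thesis
  proof (cases "?C = {}")
    case True
    then show ?thesis using that(1) C by auto
  next
    case False
    have "Max ?C \<in> ?C" using False fin by (rule Max_in[rotated])
    moreover have "\<And>x. x \<in> ?C \<Longrightarrow> x \<le> Max ?C" using fin by simp
    moreover have "calc_fill P (l # ls) a = Max ?C # calc_fill P ls (Some (Max ?C))"
      using False by (simp add: calc_fill.simps(2) Let_def)
    ultimately show ?thesis using that(2)[of "Max ?C"] unfolding C by blast
  qed
qed

declare calc_fill.simps(2) [simp del]

lemma length_calc_fill: "length (calc_fill P ls a) \<le> length ls"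
proof (induction ls arbitrary: a)
  case (Cons l ls)
  show ?case by (rule calc_fill_Cons_cases[of P l ls a]) (use Cons in auto)
qed simp

lemma calc_fill_bounds:
  "sorted_wrt (>) (calc_fill P ls a) \<and>
   (\<forall>x\<in>set (calc_fill P ls a). 0 < x \<and> x \<notin> P \<and> (\<forall>y\<in>set_option a. x < y)) \<and>
   (\<forall>r<length (calc_fill P ls a). calc_fill P ls a ! r < ls ! r)"
proof (induction ls arbitrary: a)
  case (Cons l ls)
  show ?case
  proof (rule calc_fill_Cons_cases[of P l ls a])
    fix d
    assume d: "calc_fill P (l # ls) a = d # calc_fill P ls (Some d)" "fill_candidate P l a d"
    then show ?thesis
      unfolding d(1) using Cons[of "Some d"]
      by (auto simp: fill_candidate_def nth_Cons split: nat.split intro: less_trans)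
  qed simp
qed simp

text \<open>If every entry of the new column above row \<open>r\<close> exceeded \<open>x\<close>, then \<open>x\<close> would be a candidate in
  row \<open>r\<close>, or already in the row where the filling stops, and a better choice than the one made. So
  some entry above row \<open>r\<close> is at most \<open>x\<close>. In the first such row \<open>x\<close> is still a candidate, and the
  entry, being the largest candidate, is \<open>x\<close> itself.\<close>

lemma calc_fill_gap:
  assumes "r < length ls" "0 < x" "x < ls ! r" "x \<notin> P" "\<forall>y\<in>set_option a. x < y"
    and "sorted_wrt (>) ls" and "r < length (calc_fill P ls a) \<Longrightarrow> calc_fill P ls a ! r < x"
  shows "x \<in> set (calc_fill P ls a)"
  using assms
proof (induction ls arbitrary: a r)
  case (Cons l ls)
  have "x < l"
    using Cons.prems by (cases r) (auto intro: less_trans)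
  then have fit: "fill_candidate P l a x" using Cons.prems by (simp add: fill_candidate_def)
  show ?case
  proof (rule calc_fill_Cons_cases[of P l ls a])
    fix d
    assume d: "calc_fill P (l # ls) a = d # calc_fill P ls (Some d)"
      and max: "\<And>y. fill_candidate P l a y \<Longrightarrow> y \<le> d"
    show ?thesis
    proof (cases "x = d")
      case False
      then have xd: "x < d" using max[OF fit] by simp
      then obtain r' where r': "r = Suc r'" using Cons.prems(7) d by (cases r) auto
      have "x \<in> set (calc_fill P ls (Some d))"
        by (rule Cons.IH[of r']) (use Cons.prems r' d xd in auto)
      then show ?thesis using d by simp
    qed (use d in simp)
  qed (use fit in blast)
qed simp

lemma column_Nil [simp]: "column []"
  by (simp add: column_def)

lemma column_calc_next_col: "column (calc_next_col C)"
  using calc_fill_bounds[of "set C" C None] by (simp add: column_def calc_next_col_def)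

lemma length_calc_next_col: "length (calc_next_col C) \<le> length C"
  by (simp add: calc_next_col_def length_calc_fill)

lemma calc_next_col_disjoint: "set (calc_next_col C) \<inter> set C = {}"
  using calc_fill_bounds[of "set C" C None] by (auto simp: calc_next_col_def)

lemma calc_next_col_nth_less: "r < length (calc_next_col C) \<Longrightarrow> calc_next_col C ! r < C ! r"
  using calc_fill_bounds[of "set C" C None] by (auto simp: calc_next_col_def)

lemma calc_next_col_gap:
  assumes "column C" "r < length C" "0 < x" "x < C ! r" "x \<notin> set C"
    and "r < length (calc_next_col C) \<Longrightarrow> calc_next_col C ! r < x"
  shows "x \<in> set (calc_next_col C)"
  using calc_fill_gap[of r C x "set C" None] assms by (simp add: calc_next_col_def column_def)

text \<open>The configuration of balls after \<open>k\<close> time steps.\<close>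

definition col_seq :: "nat list \<Rightarrow> nat \<Rightarrow> nat list" where
  "col_seq C k = (calc_next_col ^^ k) C"

lemma col_seq_0 [simp]: "col_seq C 0 = C"
  by (simp add: col_seq_def)

lemma col_seq_Suc: "col_seq C (Suc k) = calc_next_col (col_seq C k)"
  by (simp add: col_seq_def)

lemma col_seq_Suc': "col_seq C (Suc k) = col_seq (calc_next_col C) k"
  by (simp add: col_seq_def funpow_swap1)

lemma calc_next_col_Nil [simp]: "calc_next_col [] = []"
  by (simp add: calc_next_col_def)

lemma col_seq_Nil [simp]: "col_seq [] k = []"
  by (induction k) (simp_all add: col_seq_Suc)

lemma column_col_seq: "column C \<Longrightarrow> column (col_seq C k)"
  by (cases k) (simp_all add: col_seq_Suc column_calc_next_col)

lemma length_col_seq_antimono: "i \<le> j \<Longrightarrow> length (col_seq C j) \<le> length (col_seq C i)"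
  by (induction j rule: dec_induct)
    (auto simp: col_seq_Suc intro: le_trans[OF length_calc_next_col])

definition shape :: "nat list \<Rightarrow> partition" where
  "shape C = map (\<lambda>r. length (filter (\<lambda>col. r < length col) (calc_cols C))) [0..<length C]"

lemma calc_eq_shape: "calc mu = shape (calc_first_col mu)"
  by (simp add: calc_def shape_def Let_def)

lemma less_count_calc_cols:
  "k < length (filter (\<lambda>col. r < length col) (calc_cols C)) \<longleftrightarrow> r < length (col_seq C k)"
proof (induction C arbitrary: k rule: calc_cols.induct)
  case (1 C)
  show ?case
  proof (cases "C = []")
    case True
    then show ?thesis by (simp add: calc_cols.simps)
  next
    case False
    note IH = "1.IH"[OF False]
    show ?thesis
    proof (cases "r < length C")
      case True
      then show ?thesis
        using False IH by (cases k) (simp_all add: calc_cols.simps[of C] col_seq_Suc')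
    next
      case r: False
      then have "\<not> r < length (col_seq C j)" for j
        using length_col_seq_antimono[of 0 j C] by simp
      moreover from this[of 1] have "filter (\<lambda>col. r < length col) (calc_cols (calc_next_col C)) = []"
        using IH[of 0] by (simp add: col_seq_Suc')
      ultimately show ?thesis using False r by (simp add: calc_cols.simps[of C])
    qed
  qed
qed

lemma length_shape [simp]: "length (shape C) = length C"
  by (simp add: shape_def)

lemma less_shape_nth: "r < length C \<Longrightarrow> k < shape C ! r \<longleftrightarrow> r < length (col_seq C k)"
  by (simp add: shape_def less_count_calc_cols)

lemma is_partition_shape: "is_partition (shape C)"
  unfolding is_partition_def sorted_wrt_iff_nth_less
proof (intro conjI allI impI ballI)
  fix i j
  assume ij: "i < j" "j < length (shape C)"
  have "k < shape C ! i" if "k < shape C ! j" for k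
    using that ij less_shape_nth[of i C k] less_shape_nth[of j C k] by simp
  then show "shape C ! j \<le> shape C ! i"
    by (meson leI less_irrefl)
next
  fix x
  assume "x \<in> set (shape C)"
  then show "0 < x"
    using less_shape_nth[of _ C 0] by (auto simp: in_set_conv_nth)
qed

lemma boxes_shape: "(r, c) \<in> boxes (shape C) \<longleftrightarrow> r < length (col_seq C c)"
  using less_shape_nth[of r C c] length_col_seq_antimono[of 0 c C] by (auto simp: boxes_def)

text \<open>The number of balls that leave in step \<open>k + 1\<close>.\<close>

definition flux :: "nat list \<Rightarrow> nat \<Rightarrow> nat" where
  "flux C k = length (col_seq C k) - length (col_seq C (Suc k))"

lemma rows_of_length_shape: "rows_of_length (shape C) (Suc k) = flux C k"
proof -
  have "rows_of_length (shape C) (Suc k) = card {r. r < length C \<and> shape C ! r = Suc k}"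
    unfolding rows_of_length_def count_list_eq_length_filter length_filter_conv_card
    by (rule arg_cong[of _ _ card]) auto
  also have "{r. r < length C \<and> shape C ! r = Suc k}
      = {length (col_seq C (Suc k))..<length (col_seq C k)}"
  proof (intro set_eqI)
    fix r
    show "r \<in> {r. r < length C \<and> shape C ! r = Suc k} \<longleftrightarrow>
        r \<in> {length (col_seq C (Suc k))..<length (col_seq C k)}"
    proof (cases "r < length C")
      case True
      then have "shape C ! r = Suc k \<longleftrightarrow> k < shape C ! r \<and> \<not> Suc k < shape C ! r" by auto
      then show ?thesis
        using True less_shape_nth[OF True, of k] less_shape_nth[OF True, of "Suc k"]
        by (simp add: not_less conj_commute)
    next
      case False
      then show ?thesis using length_col_seq_antimono[of 0 k C] by auto
    qed
  qed
  finally show ?thesis by (simp add: flux_def)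
qed

section \<open>Spar labels of a shape\<close>

text \<open>The spar label is the least candidate that exceeds its neighbours and avoids the next column.
  The label placed by \<open>calc\<close> is such a candidate. A smaller one would not belong to the column,
  whose entries below row \<open>r\<close> are too small, so by \<open>calc_next_col_gap\<close> it would occur in the
  next column.\<close>

lemma spar_shape:
  assumes "column C" "r < length (col_seq C c)"
  shows "spar (shape C) r c = col_seq C c ! r"
  using assms
proof (induction "shape C" r c rule: spar.induct)
  case (1 r c)
  let ?D = "col_seq C c" and ?E = "col_seq C (Suc c)"
  have colD: "column ?D" using "1.prems" column_col_seq by blast
  then have dec: "sorted_wrt (>) ?D" and posD: "\<forall>x\<in>set ?D. 0 < x" by (auto simp: column_def)
  have below: "spar (shape C) (Suc r) c = ?D ! Suc r" if "Suc r < length ?D"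
    using that "1.hyps"(1) "1.prems" by (simp add: boxes_shape)
  have right: "spar (shape C) r (Suc c) = ?E ! r" if "r < length ?E"
    using that "1.hyps"(2) "1.prems" by (simp add: boxes_shape)
  have next_col: "spar (shape C) t (Suc c) = ?E ! t" if "t < length ?E" for t
    using that "1.hyps"(3) "1.prems" by (simp add: boxes_shape)
  define ok where "ok x \<longleftrightarrow> 0 < x \<and> (Suc r < length ?D \<longrightarrow> ?D ! Suc r < x)
      \<and> (r < length ?E \<longrightarrow> ?E ! r < x) \<and> x \<notin> set ?E" for x
  have "spar (shape C) r c = (LEAST x. 0 < x
          \<and> (Suc r < length ?D \<longrightarrow> spar (shape C) (Suc r) c < x)
          \<and> (r < length ?E \<longrightarrow> spar (shape C) r (Suc c) < x)
          \<and> (\<forall>t. t < length ?E \<longrightarrow> spar (shape C) t (Suc c) \<noteq> x))"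
    using "1.prems" by (subst spar.simps) (simp add: boxes_shape)
  also have "\<dots> = (LEAST x. ok x)"
    by (rule arg_cong[of _ _ Least])
      (auto simp: ok_def below right next_col in_set_conv_nth)
  also have "\<dots> = ?D ! r"
  proof (rule Least_equality)
    show "ok (?D ! r)"
      using "1.prems" dec posD calc_next_col_disjoint[of ?D] calc_next_col_nth_less[of r ?D]
      by (auto simp: ok_def col_seq_Suc sorted_wrt_iff_nth_less disjoint_iff)
  next
    fix x
    assume ok: "ok x"
    show "?D ! r \<le> x"
    proof (rule ccontr)
      assume "\<not> ?D ! r \<le> x"
      then have less: "x < ?D ! r" by simp
      have "x \<notin> set ?D"
      proof
        assume "x \<in> set ?D"
        then obtain t where t: "t < length ?D" "?D ! t = x" by (auto simp: in_set_conv_nth)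
        have "r < t"
          using less t dec "1.prems"(2) by (metis not_less_iff_gr_or_eq sorted_wrt_iff_nth_less)
        then have "?D ! t \<le> ?D ! Suc r"
          using dec t by (metis Suc_lessI less_imp_le order_refl sorted_wrt_iff_nth_less)
        then show False using ok t \<open>r < t\<close> by (auto simp: ok_def)
      qed
      then have "x \<in> set ?E"
        using calc_next_col_gap[OF colD "1.prems"(2)] ok less
        by (auto simp: ok_def col_seq_Suc)
      then show False using ok by (simp add: ok_def)
    qed
  qed
  finally show ?case .
qed

lemma spar_first_col_shape:
  assumes "column C"
  shows "spar_first_col (shape C) = set C"
  using spar_shape[OF assms, of _ 0]
  by (force simp: spar_first_col_def boxes_shape in_set_conv_nth)

lemma column_unique:
  assumes "column C" "column D" "set C = set D"
  shows "C = D"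
proof -
  have "sorted_wrt (<) (rev C)" "sorted_wrt (<) (rev D)"
    using assms by (simp_all add: column_def sorted_wrt_rev)
  then have "rev C = rev D"
    using assms(3) by (intro strict_sorted_equal) auto
  then show ?thesis by simp
qed

lemma shape_eq_Nil_iff [simp]: "shape C = [] \<longleftrightarrow> C = []"
  by (simp add: shape_def)

lemma wt_label_shape:
  assumes "column C"
  shows "wt_label (shape C) = (if C = [] then 0 else hd C)"
  using spar_shape[OF assms, of 0 0] by (simp add: wt_label_def hd_conv_nth)

lemma wt_label_shape_Max:
  assumes "column C"
  shows "wt_label (shape C) = Max (insert 0 (set C))"
proof (cases C)
  case Nil
  then show ?thesis using wt_label_shape[OF assms] by simp
next
  case (Cons c C')
  then have "Max (insert 0 (set C)) = c"
    using assms by (intro Max_eqI) (auto simp: column_def)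
  then show ?thesis using wt_label_shape[OF assms] Cons by simp
qed

section \<open>Complementary columns and orth\<close>

definition complement :: "nat \<Rightarrow> nat list \<Rightarrow> nat list" where
  "complement w C = rev (sorted_list_of_set ({1..w} - set C))"

lemma column_complement [simp]: "column (complement w C)"
  using strict_sorted_list_of_set[of "{1..w} - set C"]
  by (auto simp: column_def complement_def sorted_wrt_rev)

lemma set_complement: "set (complement w C) = {1..w} - set C"
  by (simp add: complement_def)

lemma col_len_eq_length_filter: "col_len lam t = length (filter (\<lambda>x. t \<le> x) lam)"
  unfolding col_len_def length_filter_conv_card by (rule arg_cong[of _ _ card]) auto

lemma num_cols_eq_Max: "num_cols lam = Max (insert 0 (set lam))"
proof -
  have "{t. 1 \<le> t \<and> 0 < col_len lam t} = {1..Max (insert 0 (set lam))}"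
    by (auto simp: col_len_eq_length_filter filter_empty_conv Max_ge_iff)
  then show ?thesis by (simp add: num_cols_def)
qed

lemma column_calc_first_col: "column (calc_first_col mu)"
  using strict_sorted_list_of_set[of "{t \<in> {1..num_cols mu}. odd (col_len mu t)}"]
  by (auto simp: column_def calc_first_col_def sorted_wrt_rev)

lemma set_calc_first_col: "set (calc_first_col mu) = {t. 1 \<le> t \<and> odd (col_len mu t)}"
proof -
  have "t \<le> num_cols mu" if "odd (col_len mu t)" for t
  proof -
    have "filter (\<lambda>x. t \<le> x) mu \<noteq> []"
      using that unfolding col_len_eq_length_filter by fastforce
    then show ?thesis by (auto simp: num_cols_eq_Max filter_empty_conv Max_ge_iff)
  qed
  then show ?thesis by (auto simp: calc_first_col_def)
qed

text \<open>The row lengths of a two-regular partition are no labels, but they form a strictly decreasing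
  list of positive integers, so the lemmas on columns apply to them.\<close>

lemma two_regular_iff_column: "two_regular mu \<longleftrightarrow> column mu"
proof -
  have "sorted_wrt (\<ge>) mu \<and> distinct mu \<longleftrightarrow> sorted_wrt (>) mu" for mu :: "nat list"
    by (induction mu) (auto simp: le_less)
  then show ?thesis by (auto simp: two_regular_def is_partition_def column_def)
qed

lemma col_len_Suc:
  assumes "column mu"
  shows "col_len mu t = col_len mu (Suc t) + of_bool (t \<in> set mu)"
  using assms
  by (induction mu) (auto simp: col_len_eq_length_filter column_def)

text \<open>Adjacent column lengths of a two-regular partition differ by at most \<open>1\<close>, so their parities
  reveal where the rows end.\<close>

lemma two_regular_unique:
  assumes "two_regular mu" "two_regular nu"
    and "\<forall>t\<ge>1. odd (col_len mu t) \<longleftrightarrow> odd (col_len nu t)"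
  shows "mu = nu"
proof (rule column_unique)
  show mu: "column mu" and nu: "column nu" using assms two_regular_iff_column by auto
  have "t \<in> set mu \<longleftrightarrow> t \<in> set nu" if "1 \<le> t" for t
    using col_len_Suc[OF mu, of t] col_len_Suc[OF nu, of t] assms(3)[rule_format, of t]
      assms(3)[rule_format, of "Suc t"] that
    by (cases "t \<in> set mu"; cases "t \<in> set nu") auto
  then show "set mu = set nu" using mu nu by (auto simp: column_def Suc_le_eq)
qed

text \<open>A row of length \<open>t\<close> is needed exactly where the prescribed parities of the columns \<open>t\<close> and
  \<open>t + 1\<close> differ.\<close>

lemma two_regular_exists:
  assumes "S \<subseteq> {1..w}"
  shows "\<exists>mu. two_regular mu \<and> (\<forall>t\<ge>1. odd (col_len mu t) \<longleftrightarrow> t \<in> S)"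
proof -
  let ?mu = "complement w [t\<leftarrow>[1..<Suc w]. t \<in> S \<longleftrightarrow> Suc t \<in> S]"
  have set_mu: "t \<in> set ?mu \<longleftrightarrow> t \<in> {1..w} \<and> (t \<in> S \<longleftrightarrow> Suc t \<notin> S)" for t
    by (auto simp: set_complement)
  have "odd (col_len ?mu t) \<longleftrightarrow> t \<in> S" if "1 \<le> t" for t
  proof (cases "t \<le> Suc w")
    case True
    then show ?thesis using that
    proof (induction t rule: inc_induct)
      case base
      then show ?case using assms
        by (auto simp: col_len_eq_length_filter filter_empty_conv set_complement)
    next
      case (step t)
      then show ?case using col_len_Suc[of ?mu t] set_mu[of t] by auto
    qed
  next
    case False
    then have "filter (\<lambda>x. t \<le> x) ?mu = []" by (auto simp: filter_empty_conv set_complement)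
    then show ?thesis using False assms by (auto simp: col_len_eq_length_filter)
  qed
  then show ?thesis using two_regular_iff_column column_complement by blast
qed

lemma ord_part_shape:
  assumes "column C"
  shows "column (ord_part (shape C))"
    and "1 \<le> t \<Longrightarrow> odd (col_len (ord_part (shape C)) t) \<longleftrightarrow> t \<in> set C"
proof -
  let ?P = "\<lambda>mu. two_regular mu \<and> (\<forall>t\<ge>1. odd (col_len mu t) \<longleftrightarrow> t \<in> set C)"
  have "set C \<subseteq> {1..Max (insert 0 (set C))}" using assms by (auto simp: column_def Suc_le_eq)
  then obtain mu where mu: "?P mu" using two_regular_exists by blast
  moreover have "nu = mu" if "?P nu" for nu using two_regular_unique[of nu mu] that mu by blast
  ultimately have "?P (ord_part (shape C))"
    unfolding ord_part_def spar_first_col_shape[OF assms] by (rule theI)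
  then show "column (ord_part (shape C))"
    and "1 \<le> t \<Longrightarrow> odd (col_len (ord_part (shape C)) t) \<longleftrightarrow> t \<in> set C"
    using two_regular_iff_column by auto
qed

text \<open>A row of length \<open>w\<close> flips the parity of the columns \<open>1, \<dots>, w\<close>, whether it is added or removed.
  When the top row of \<open>ord_part\<close> is removed, its length is \<open>w\<close>, because it is the index of the last
  column of odd length.\<close>

lemma orth_shape:
  assumes C: "column C" and w: "wt_label (shape C) \<le> w"
  shows "orth w (shape C) = shape (complement w C)"
proof -
  let ?mu = "ord_part (shape C)"
  note mu = ord_part_shape[OF C]
  have le: "t \<le> wt_label (shape C)" if "t \<in> set C" for t
    using that wt_label_shape_Max[OF C] by simp
  have parity: "odd (col_len (ext_part w (shape C)) t) \<longleftrightarrow> t \<le> w \<and> t \<notin> set C" if t: "1 \<le> t" for t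
  proof (cases "wt_label (shape C) < w")
    case True
    then have "col_len (ext_part w (shape C)) t = of_bool (t \<le> w) + col_len ?mu t"
      by (simp add: ext_part_def add_top_row_def col_len_eq_length_filter)
    then show ?thesis using mu(2)[OF t] le[of t] True by auto
  next
    case False
    with w have wt: "wt_label (shape C) = w" by simp
    then have ext: "ext_part w (shape C) = tl ?mu" by (simp add: ext_part_def)
    show ?thesis
    proof (cases ?mu)
      case Nil
      have "s \<notin> set C" for s
      proof
        assume s: "s \<in> set C"
        then have "1 \<le> s" using C by (simp add: column_def Suc_le_eq)
        then show False using mu(2)[of s] s Nil by (simp add: col_len_eq_length_filter)
      qed
      then have "C = []" by (cases C) auto
      then have "w = 0" using wt wt_label_shape[OF C] by simp
      then show ?thesis using t ext Nil by (simp add: col_len_eq_length_filter)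
    next
      case (Cons x nu)
      have x: "0 < x" "\<forall>y\<in>set nu. y < x" using mu(1) Cons by (auto simp: column_def)
      have "filter (\<lambda>y. s \<le> y) nu = []" if "x \<le> s" for s
        using x that by (auto simp: filter_empty_conv)
      then have "odd (col_len ?mu s) \<longleftrightarrow> s = x" if "x \<le> s" for s
        using that Cons by (simp add: col_len_eq_length_filter)
      moreover have "odd (col_len ?mu s) \<longleftrightarrow> s \<in> set C" if "x \<le> s" for s
        using mu(2)[of s] x(1) that by simp
      ultimately have "s \<in> set C \<longleftrightarrow> s = x" if "x \<le> s" for s
        using that by blast
      then have "x \<in> set C" "\<And>s. s \<in> set C \<Longrightarrow> s \<le> x"
        by (blast, metis linear order_refl)
      then have "Max (insert 0 (set C)) = x"
        by (intro Max_eqI) auto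
      then have "x = w" using wt wt_label_shape_Max[OF C] by simp
      then have "col_len ?mu t = of_bool (t \<le> w) + col_len (tl ?mu) t"
        using Cons by (simp add: col_len_eq_length_filter)
      then show ?thesis using mu(2)[OF t] le[of t] wt ext by auto
    qed
  qed
  have "set (calc_first_col (ext_part w (shape C))) = set (complement w C)"
    unfolding set_calc_first_col set_complement using parity by (intro set_eqI) fastforce
  then have "calc_first_col (ext_part w (shape C)) = complement w C"
    by (intro column_unique column_calc_first_col column_complement)
  then show ?thesis by (simp add: orth_def calc_eq_shape)
qed

section \<open>A box that balls pass\<close>

text \<open>A new box at the left end of a box-ball system, seen over time: \<open>s k\<close> says whether the box
  is occupied before step \<open>k\<close>, \<open>u k\<close> balls arrive from the right in that step and \<open>u' k\<close> balls leave
  to the left. An occupied box becomes empty, and an empty one keeps one ball if some ball arrives.\<close>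

definition transit :: "(nat \<Rightarrow> bool) \<Rightarrow> (nat \<Rightarrow> nat) \<Rightarrow> (nat \<Rightarrow> nat) \<Rightarrow> bool" where
  "transit s u u' \<longleftrightarrow>
     (\<forall>k. (s (Suc k) \<longleftrightarrow> \<not> s k \<and> 0 < u k) \<and>
          u' k + of_bool (s (Suc k)) = u k + of_bool (s k))"

lemma transit_state: "transit s u u' \<Longrightarrow> s (Suc k) \<longleftrightarrow> \<not> s k \<and> 0 < u k"
  by (simp add: transit_def)

lemma transit_out: "transit s u u' \<Longrightarrow> int (u' k) = int (u k) + of_bool (s k) - of_bool (s (Suc k))"
proof -
  assume "transit s u u'"
  then have "int (u' k + of_bool (s (Suc k))) = int (u k + of_bool (s k))"
    unfolding transit_def by metis
  then show ?thesis by simp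
qed

text \<open>The transducer is reversible: the outputs determine the earlier state from the later one,
  by the same rule as in the forward direction.\<close>

lemma transit_state_back: "transit s u u' \<Longrightarrow> s k \<longleftrightarrow> \<not> s (Suc k) \<and> 0 < u' k"
  using transit_state[of s u u' k] transit_out[of s u u' k]
  by (cases "s k"; cases "s (Suc k)") auto

lemma transit_deterministic:
  assumes "transit s u u'" "transit r u v'" "s 0 = r 0"
  shows "u' = v'"
proof -
  have sr: "s k = r k" for k
    by (induction k) (use assms in \<open>auto simp: transit_state\<close>)
  show ?thesis
  proof
    fix k
    have "int (u' k) = int (v' k)"
      using transit_out[OF assms(1)] transit_out[OF assms(2)] sr by simp
    then show "u' k = v' k" by simp
  qed
qed

text \<open>Reversibility turns a finite output sequence into its input: the states are computed
  downwards from the empty box at the end of time.\<close>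

lemma transit_back_exists:
  assumes "\<forall>k\<ge>N. u' k = 0"
  shows "\<exists>s u. transit s u u' \<and> (\<forall>k\<ge>N. \<not> s k \<and> u k = 0)"
proof -
  have "\<exists>s. (\<forall>k\<ge>N. \<not> s k) \<and> (\<forall>k. s k \<longleftrightarrow> \<not> s (Suc k) \<and> 0 < u' k)"
    using assms
  proof (induction N arbitrary: u')
    case 0
    then show ?case by (intro exI[of _ "\<lambda>_. False"]) auto
  next
    case (Suc N)
    have "\<forall>k\<ge>N. u' (Suc k) = 0" using Suc.prems by simp
    from Suc.IH[OF this] obtain s where
      s: "\<forall>k\<ge>N. \<not> s k" "\<forall>k. s k \<longleftrightarrow> \<not> s (Suc k) \<and> 0 < u' (Suc k)" by blast
    let ?s = "case_nat (\<not> s 0 \<and> 0 < u' 0) s"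
    have "\<forall>k\<ge>Suc N. \<not> ?s k"
      using s(1) by (simp split: nat.split)
    moreover have "?s k \<longleftrightarrow> \<not> ?s (Suc k) \<and> 0 < u' k" for k
      using s(2)[rule_format, of "k - 1"] by (cases k) simp_all
    ultimately show ?case by blast
  qed
  then obtain s where s: "\<forall>k\<ge>N. \<not> s k" "\<forall>k. s k \<longleftrightarrow> \<not> s (Suc k) \<and> 0 < u' k" by blast
  let ?u = "\<lambda>k. u' k + of_bool (s (Suc k)) - of_bool (s k)"
  have "transit s ?u u'"
    unfolding transit_def
  proof
    fix k
    show "(s (Suc k) \<longleftrightarrow> \<not> s k \<and> 0 < ?u k) \<and> u' k + of_bool (s (Suc k)) = ?u k + of_bool (s k)"
      using s(2)[rule_format, of k] by (cases "s k"; cases "s (Suc k)") auto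
  qed
  moreover have "\<forall>k\<ge>N. \<not> s k \<and> ?u k = 0" using s(1) assms by auto
  ultimately show ?thesis by blast
qed

lemma transit_sum:
  assumes "transit s u u'"
  shows "(\<Sum>k<N. int (u' k)) = (\<Sum>k<N. int (u k)) + of_bool (s 0) - of_bool (s N)"
  by (induction N) (simp_all add: transit_out[OF assms])

text \<open>Run backwards, the transducer decreases this weighted sum, which counts the boxes of the
  partition with the given row multiplicities, unless the box is never occupied.\<close>

lemma transit_weighted_sum:
  assumes "transit s u u'"
  shows "(\<Sum>k<N. int (Suc k) * int (u' k))
    = (\<Sum>k<N. int (Suc k) * int (u k)) + (\<Sum>k<N. of_bool (s k)) - int N * of_bool (s N)"
  by (induction N) (simp_all add: transit_out[OF assms] algebra_simps)

section \<open>Inserting a position into the box-ball system\<close>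

text \<open>All balls move one position to the right, and a new first position, occupied if \<open>b\<close> holds,
  is inserted.\<close>

definition shift_col :: "bool \<Rightarrow> nat list \<Rightarrow> nat list" where
  "shift_col b C = map Suc C @ (if b then [1] else [])"

lemma length_shift_col [simp]: "length (shift_col b C) = length C + of_bool b"
  by (simp add: shift_col_def)

lemma set_shift_col: "set (shift_col b C) = Suc ` set C \<union> (if b then {1} else {})"
  by (simp add: shift_col_def)

lemma column_shift_col: "column C \<Longrightarrow> column (shift_col b C)"
  by (auto simp: column_def shift_col_def sorted_wrt_append sorted_wrt_map)

lemma calc_fill_one: "calc_fill P ls (Some 1) = []"
proof (cases ls)
  case (Cons l ls')
  show ?thesis
    unfolding Cons by (rule calc_fill_Cons_cases[of P l ls' "Some 1"]) (auto simp: fill_candidate_def)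
qed simp

text \<open>With a new first position, a ball that used to leave finds the position \<open>1\<close> if it is free. Only
  the first such ball can take it, because the labels of a column decrease. The condition on
  \<open>a\<close> fails only for a box whose shifted label is \<open>1\<close>, below which nothing fits.\<close>

lemma calc_fill_shift:
  assumes "0 \<notin> P" "\<forall>l\<in>set ls. 0 < l"
  shows "calc_fill (Suc ` P \<union> (if b then {1} else {})) (map Suc ls @ (if b then [1] else []))
      (map_option Suc a)
    = map Suc (calc_fill P ls a) @
      (if \<not> b \<and> (\<forall>y\<in>set_option a. 0 < y) \<and> length (calc_fill P ls a) < length ls then [1] else [])"
  using assms(2)
proof (induction ls arbitrary: a)
  case Nil
  show ?case by (simp add: calc_fill.simps(2))
next
  case (Cons l ls)
  let ?P = "Suc ` P \<union> (if b then {1} else {})" and ?a = "map_option Suc a"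
    and ?ls = "map Suc ls @ (if b then [1] else [])"
  have Suc: "fill_candidate ?P (Suc l) ?a (Suc y) \<longleftrightarrow> fill_candidate P l a y" if "0 < y" for y
    using that by (cases a) (auto simp: fill_candidate_def)
  have one: "fill_candidate ?P (Suc l) ?a 1 \<longleftrightarrow> \<not> b \<and> (\<forall>y\<in>set_option a. 0 < y)"
    using Cons.prems assms(1) by (cases a) (auto simp: fill_candidate_def)
  have pred: "\<exists>y. x = Suc y \<and> 0 < y \<and> fill_candidate P l a y"
    if "fill_candidate ?P (Suc l) ?a x" "x \<noteq> 1" for x
    using that Suc by (cases x) (auto simp: fill_candidate_def[of _ _ _ "0::nat"])
  show ?case
  proof (rule calc_fill_Cons_cases[of P l ls a])
    assume none: "calc_fill P (l # ls) a = []" "\<And>x. \<not> fill_candidate P l a x"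
    then have only: "x = 1" if "fill_candidate ?P (Suc l) ?a x" for x using pred[OF that] by blast
    show ?thesis
    proof (rule calc_fill_Cons_cases[of ?P "Suc l" ?ls ?a])
      assume "calc_fill ?P (Suc l # ?ls) ?a = []" "\<And>x. \<not> fill_candidate ?P (Suc l) ?a x"
      then show ?thesis using none(1) one by auto
    next
      fix d
      assume "calc_fill ?P (Suc l # ?ls) ?a = d # calc_fill ?P ?ls (Some d)"
        and "fill_candidate ?P (Suc l) ?a d"
      then show ?thesis
        using none(1) one only[of d] by (auto simp: calc_fill_one[unfolded One_nat_def])
    qed
  next
    fix d
    assume d: "calc_fill P (l # ls) a = d # calc_fill P ls (Some d)" "fill_candidate P l a d"
      and max: "\<And>y. fill_candidate P l a y \<Longrightarrow> y \<le> d"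
    have d0: "0 < d" using d(2) by (simp add: fill_candidate_def)
    have sd: "fill_candidate ?P (Suc l) ?a (Suc d)" using Suc[OF d0] d(2) by blast
    have pos: "\<forall>y\<in>set_option a. 0 < y" using d(2) by (auto simp: fill_candidate_def)
    show ?thesis
    proof (rule calc_fill_Cons_cases[of ?P "Suc l" ?ls ?a])
      fix e
      assume e: "calc_fill ?P (Suc l # ?ls) ?a = e # calc_fill ?P ?ls (Some e)"
        "fill_candidate ?P (Suc l) ?a e" "\<And>x. fill_candidate ?P (Suc l) ?a x \<Longrightarrow> x \<le> e"
      have "e \<le> Suc d" using pred[OF e(2)] max by fastforce
      then have "e = Suc d" using e(3)[OF sd] by simp
      then show ?thesis
        using e(1) d(1) d0 pos Cons.IH[of "Some d"] Cons.prems by simp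
    qed (use sd in blast)
  qed
qed

lemma calc_next_col_shift_col:
  assumes "column C"
  shows "calc_next_col (shift_col b C)
    = shift_col (\<not> b \<and> length (calc_next_col C) < length C) (calc_next_col C)"
  using calc_fill_shift[of "set C" C b None] assms
  by (force simp: calc_next_col_def shift_col_def column_def)

lemma transit_shift_col:
  assumes "column C"
  obtains s where "s 0 = b" "transit s (flux C) (flux (shift_col b C))"
proof -
  define s where "s = rec_nat b (\<lambda>k x. \<not> x \<and> 0 < flux C k)"
  have s: "s 0 = b" "\<And>k. s (Suc k) \<longleftrightarrow> \<not> s k \<and> 0 < flux C k" by (simp_all add: s_def)
  have seq: "col_seq (shift_col b C) k = shift_col (s k) (col_seq C k)" for k
  proof (induction k)
    case (Suc k)
    then show ?case
      using calc_next_col_shift_col[OF column_col_seq[OF assms]]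
      by (simp add: col_seq_Suc s(2) flux_def)
  qed (simp add: s(1))
  have "transit s (flux C) (flux (shift_col b C))"
    unfolding transit_def
  proof
    fix k
    have "length (col_seq C (Suc k)) \<le> length (col_seq C k)"
      by (rule length_col_seq_antimono) simp
    then show "(s (Suc k) \<longleftrightarrow> \<not> s k \<and> 0 < flux C k) \<and>
        flux (shift_col b C) k + of_bool (s (Suc k)) = flux C k + of_bool (s k)"
      using s(2)[of k] by (auto simp: flux_def seq)
  qed
  with s(1) show ?thesis using that by blast
qed

primrec col_of :: "bool list \<Rightarrow> nat list" where
  "col_of [] = []"
| "col_of (b # bs) = shift_col b (col_of bs)"

lemma column_col_of [simp]: "column (col_of bs)"
  by (induction bs) (simp_all add: column_shift_col)

lemma in_set_col_of: "x \<in> set (col_of bs) \<longleftrightarrow> 0 < x \<and> x \<le> length bs \<and> bs ! (x - 1)"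
proof (induction bs arbitrary: x)
  case (Cons b bs)
  show ?case
  proof (cases x)
    case (Suc y)
    then show ?thesis using Cons.IH[of y] by (cases y) (auto simp: set_shift_col)
  qed (auto simp: set_shift_col)
qed auto

lemma length_col_of_Not: "length (col_of bs) + length (col_of (map Not bs)) = length bs"
  by (induction bs) auto

lemma complement_col_of: "complement (length bs) (col_of bs) = col_of (map Not bs)"
  by (rule column_unique) (auto simp: set_complement in_set_col_of)

text \<open>A column with entries in \<open>{1..w}\<close> is a word of length \<open>w\<close>. The words make the number of
  positions explicit, which the column alone does not determine, and the complement in \<open>{1..w}\<close>
  becomes the negated word.\<close>

lemma column_word:
  assumes "column C" "set C \<subseteq> {1..w}"
  obtains bs where "length bs = w" "C = col_of bs"
proof
  let ?bs = "map (\<lambda>i. Suc i \<in> set C) [0..<w]"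
  show "length ?bs = w" by simp
  show "C = col_of ?bs"
  proof (rule column_unique[OF assms(1) column_col_of set_eqI])
    fix x
    show "x \<in> set C \<longleftrightarrow> x \<in> set (col_of ?bs)"
      using assms(2) by (cases x) (auto simp: in_set_col_of)
  qed
qed

lemma flux_Nil [simp]: "flux [] k = 0"
  by (simp add: flux_def)

lemma flux_col_of_Cons:
  obtains s where "s 0 = b" "transit s (flux (col_of bs)) (flux (col_of (b # bs)))"
  using transit_shift_col[OF column_col_of, of b bs] by auto

text \<open>For a single sequence a backward step need not remove a row, but it always removes a box.\<close>

lemma word_of_flux:
  assumes "\<forall>k\<ge>N. u k = 0"
  shows "\<exists>bs. u = flux (col_of bs)"
  using assms
proof (induction "\<Sum>k<N. Suc k * u k" arbitrary: u rule: less_induct)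
  case less
  show ?case
  proof (cases "\<exists>k. 0 < u k")
    case False
    then have "u = flux (col_of [])" by auto
    then show ?thesis by blast
  next
    case True
    then obtain k where k: "0 < u k" by blast
    obtain s u0 where s: "transit s u0 u" "\<forall>k\<ge>N. \<not> s k \<and> u0 k = 0"
      using transit_back_exists[OF less.prems] by blast
    \<comment> \<open>A ball that leaves comes from the box, unless the box has kept another one.\<close>
    have "s k \<or> s (Suc k)" using transit_state_back[OF s(1), of k] k by blast
    then obtain j where j: "s j" by blast
    then have "j < N" using s(2) by (meson not_le)
    have "(1::int) = (\<Sum>i\<in>{j}. of_bool (s i))" using j by simp
    also have "\<dots> \<le> (\<Sum>i<N. of_bool (s i))" using \<open>j < N\<close> by (intro sum_mono2) auto
    finally have "(\<Sum>k<N. int (Suc k) * int (u0 k)) < (\<Sum>k<N. int (Suc k) * int (u k))"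
      using transit_weighted_sum[OF s(1), of N] s(2) by simp
    then have "int (\<Sum>k<N. Suc k * u0 k) < int (\<Sum>k<N. Suc k * u k)"
      by (simp only: of_nat_sum of_nat_mult)
    then have "(\<Sum>k<N. Suc k * u0 k) < (\<Sum>k<N. Suc k * u k)" by linarith
    then obtain bs where bs: "u0 = flux (col_of bs)" using less.hyps[of u0] s(2) by blast
    obtain s' where s': "s' 0 = s 0" "transit s' u0 (flux (col_of (s 0 # bs)))"
      using flux_col_of_Cons[of "s 0" bs] bs by metis
    show ?thesis using transit_deterministic[OF s(1) s'(2) s'(1)[symmetric]] by blast
  qed
qed

section \<open>Balanced pairs of sequences\<close>

text \<open>For the row multiplicities \<open>u\<close> and \<open>v\<close> of two partitions, indexed from \<open>0\<close>, this is
  the negative of one of the four sums in the definition of an MV polytope.\<close>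

definition excess :: "(nat \<Rightarrow> nat) \<Rightarrow> (nat \<Rightarrow> nat) \<Rightarrow> nat \<Rightarrow> int" where
  "excess u v m = (\<Sum>k<m. int (Suc k) * (int (u k) - int (v (Suc k))))"

lemma excess_0 [simp]: "excess u v 0 = 0"
  by (simp add: excess_def)

lemma excess_Suc: "excess u v (Suc m) = excess u v m + int (Suc m) * (int (u m) - int (v (Suc m)))"
  by (simp add: excess_def)

text \<open>In the sum of the two excesses the weights telescope, so for finite sequences and large \<open>m\<close> it
  is the total number of rows.\<close>

lemma excess_add_swap:
  "excess u v m + excess v u m = (\<Sum>k<m. int (u k) + int (v k)) - int m * (int (u m) + int (v m))"
  by (induction m) (simp_all add: excess_Suc algebra_simps)

definition balanced :: "(nat \<Rightarrow> nat) \<Rightarrow> (nat \<Rightarrow> nat) \<Rightarrow> bool" where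
  "balanced u v \<longleftrightarrow>
     (\<forall>m. 0 \<le> excess u v m \<and> 0 \<le> excess v u m \<and> (excess u v m = 0 \<or> excess v u m = 0))"

lemma balanced_sym: "balanced u v \<Longrightarrow> balanced v u"
  unfolding balanced_def by blast

lemma balancedD:
  assumes "balanced u v"
  shows "0 \<le> excess u v m" "0 \<le> excess v u m" "0 < excess u v m \<Longrightarrow> excess v u m = 0"
  using assms unfolding balanced_def by force+

section \<open>Alternating boxes and balanced pairs\<close>

text \<open>If the occupied times of \<open>s\<close> and \<open>r\<close> alternate, then \<open>p m\<close> is \<open>1\<close> exactly when at time \<open>m\<close>
  both boxes are empty, \<open>s\<close> was the last one to be occupied, and \<open>r\<close> is awaited.\<close>

definition waiting :: "(nat \<Rightarrow> bool) \<Rightarrow> (nat \<Rightarrow> bool) \<Rightarrow> (nat \<Rightarrow> int) \<Rightarrow> bool" where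
  "waiting s r p \<longleftrightarrow> p 0 = 0 \<and> (\<forall>m. p (Suc m) = p m + of_bool (s m) - of_bool (r (Suc m)))"

lemma waiting_Suc: "waiting s r p \<Longrightarrow> p (Suc m) = p m + of_bool (s m) - of_bool (r (Suc m))"
  by (simp add: waiting_def)

lemma waiting_0: "waiting s r p \<Longrightarrow> p 0 = 0"
  by (simp add: waiting_def)

text \<open>The transducers change \<open>u m - v (m + 1)\<close> by the negative of a second difference of \<open>p\<close>, and
  summation by parts leaves only two boundary terms.\<close>

lemma excess_transit:
  assumes u: "transit s u u'" and v: "transit r v v'" and p: "waiting s r p"
  shows "excess u' v' m = excess u v m + int (Suc m) * p m - int m * p (Suc m)"
proof (induction m)
  case 0
  show ?case using waiting_0[OF p] by simp
next
  case (Suc m)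
  have step: "int (u' m) - int (v' (Suc m))
      = int (u m) - int (v (Suc m)) + 2 * p (Suc m) - p m - p (Suc (Suc m))"
    using waiting_Suc[OF p, of m] waiting_Suc[OF p, of "Suc m"]
      transit_out[OF u, of m] transit_out[OF v, of "Suc m"] by simp
  show ?case
    unfolding excess_Suc Suc.IH step by (simp add: algebra_simps)
qed

text \<open>The first box is occupied, or was the last one to be occupied. Unless the second box becomes
  occupied next, \<open>v\<close> vanishes at this time; then \<open>excess v u\<close> is zero, and a positive entry of \<open>u\<close>
  would make it negative. So nothing arrives at the first box before the second one is occupied,
  and the occupied times alternate.\<close>

lemma phase_step:
  assumes bal: "balanced u v" and u: "transit s u u'" and v: "transit r v v'"
    and p: "waiting s r p" and q: "waiting r s q"
    and act: "s m \<or> p m = 1" and r: "\<not> r m" "q m = 0" and sp: "\<not> s m \<or> p m = 0"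
    and w: "p m = 1 \<Longrightarrow> u m = 0 \<and> excess v u m = 0"
  shows "\<not> s (Suc m) \<and> q (Suc m) = 0 \<and> p (Suc m) = 1 - of_bool (r (Suc m)) \<and>
    (\<not> r (Suc m) \<longrightarrow> u (Suc m) = 0 \<and> excess v u (Suc m) = 0)"
proof -
  have s': "\<not> s (Suc m)"
    using act w transit_state[OF u, of m] by auto
  have "u (Suc m) = 0 \<and> excess v u (Suc m) = 0" if nr: "\<not> r (Suc m)"
  proof -
    from nr r have vm: "v m = 0" using transit_state[OF v, of m] by auto
    have "excess v u m = 0"
    \<comment> \<open>An occupied first box received a ball one step before; since \<open>v\<close> vanishes now, \<open>excess u v\<close> is
      positive.\<close>
    proof (cases "p m = 1 \<or> m = 0")
      case False
      with act obtain k where k: "m = Suc k" "s (Suc k)" by (cases m) auto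
      then have "0 < u k" using transit_state[OF u, of k] by auto
      moreover have "v (Suc k) = 0" using vm k by simp
      ultimately have "0 < excess u v m"
        using k excess_Suc[of u v k] balancedD(1)[OF bal, of k] by (simp add: add_nonneg_pos)
      then show ?thesis using balancedD(3)[OF bal] by blast
    qed (use w in auto)
    then have ex: "excess v u (Suc m) = - (int (Suc m) * int (u (Suc m)))"
      using vm by (simp add: excess_Suc)
    have "0 \<le> excess v u (Suc m)" using balancedD(2)[OF bal] .
    moreover have "0 \<le> int (Suc m) * int (u (Suc m))" by simp
    ultimately have "int (Suc m) * int (u (Suc m)) = 0" using ex by linarith
    then show ?thesis using ex by simp
  qed
  moreover have "p (Suc m) = 1 - of_bool (r (Suc m))"
    using waiting_Suc[OF p, of m] act sp by auto
  moreover have "q (Suc m) = 0"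
    using waiting_Suc[OF q, of m] r s' by simp
  ultimately show ?thesis using s' by blast
qed

text \<open>At each time exactly one of four phases holds: the first box is occupied, the second box
  is occupied, the second one is awaited (\<open>p m = 1\<close>), or the first one is awaited (\<open>q m = 1\<close>).\<close>

definition one_phase :: "(nat \<Rightarrow> bool) \<Rightarrow> (nat \<Rightarrow> bool) \<Rightarrow> (nat \<Rightarrow> int) \<Rightarrow> (nat \<Rightarrow> int) \<Rightarrow> nat \<Rightarrow> bool" where
  "one_phase s r p q m \<longleftrightarrow> p m \<in> {0, 1} \<and> q m \<in> {0, 1} \<and> of_bool (s m) + of_bool (r m) + p m + q m = 1"

text \<open>The four phases, grouped by the box that was occupied last (for forward steps) or that
  will be occupied next (for backward steps).\<close>

lemma one_phase_cases:
  assumes "one_phase s r p q m"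
  obtains "s m \<or> p m = 1" "\<not> r m" "q m = 0" "\<not> s m \<or> p m = 0"
  | "r m \<or> q m = 1" "\<not> s m" "p m = 0" "\<not> r m \<or> q m = 0"
  using assms unfolding one_phase_def by (cases "s m"; cases "r m") auto

lemma one_phase_cases_back:
  assumes "one_phase s r p q m"
  obtains "s m \<or> q m = 1" "\<not> r m" "p m = 0" "\<not> s m \<or> q m = 0"
  | "r m \<or> p m = 1" "\<not> s m" "q m = 0" "\<not> r m \<or> p m = 0"
  using assms unfolding one_phase_def by (cases "s m"; cases "r m") auto

lemma phases_forward:
  assumes bal: "balanced u v" and u: "transit s u u'" and v: "transit r v v'"
    and sr: "s 0 \<noteq> r 0" and p: "waiting s r p" and q: "waiting r s q"
  shows "one_phase s r p q m \<and> (p m = 1 \<longrightarrow> u m = 0 \<and> excess v u m = 0)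
    \<and> (q m = 1 \<longrightarrow> v m = 0 \<and> excess u v m = 0)"
proof (induction m)
  case 0
  show ?case using sr waiting_0[OF p] waiting_0[OF q] by (auto simp: one_phase_def)
next
  case (Suc m)
  from Suc have "one_phase s r p q m" by blast
  then show ?case
  proof (cases rule: one_phase_cases)
    case 1
    from phase_step[OF bal u v p q 1] Suc show ?thesis
      by (auto simp: one_phase_def)
  next
    case 2
    from phase_step[OF balanced_sym[OF bal] v u q p 2] Suc show ?thesis
      by (auto simp: one_phase_def)
  qed
qed

lemma waiting_exists: "\<exists>p. waiting s r p"
  unfolding waiting_def
  by (rule exI[of _ "\<lambda>m. \<Sum>k<m. of_bool (s k) - of_bool (r (Suc k))"]) simp

text \<open>In the phases next to a wait for the second box, only \<open>excess u v\<close> changes and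
  \<open>excess v u\<close> is zero. The one decrease is by \<open>m\<close>, at the beginning of a wait; it is compensated
  because the occupied first box has just received a ball, which has put \<open>excess u v\<close> to at
  least \<open>m\<close>.\<close>

lemma excess_transit_forward:
  assumes bal: "balanced u v" and u: "transit s u u'" and v: "transit r v v'"
    and p: "waiting s r p" and q: "waiting r s q"
    and ph: "one_phase s r p q m" "one_phase s r p q (Suc m)"
    and pw: "p m = 1 \<Longrightarrow> excess v u m = 0"
      "p (Suc m) = 1 \<Longrightarrow> excess v u (Suc m) = 0 \<and> u (Suc m) = 0"
    and pm: "p m = 1 \<or> p (Suc m) = 1"
  shows "0 \<le> excess u' v' m \<and> excess v' u' m = 0"
proof -
  note p' = waiting_Suc[OF p, of m] and q' = waiting_Suc[OF q, of m]
  have a': "excess u' v' m = excess u v m + int (Suc m) * p m - int m * p (Suc m)"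
    and b': "excess v' u' m = excess v u m + int (Suc m) * q m - int m * q (Suc m)"
    using excess_transit[OF u v p] excess_transit[OF v u q] by blast+
  have a0: "0 \<le> excess u v m" "0 \<le> excess v u m" using balancedD[OF bal] by blast+
  show ?thesis
  proof (cases "p m = 1")
    case True
    then have "q m = 0" "q (Suc m) = 0" "p (Suc m) \<in> {0,1}"
      using ph q' p' unfolding one_phase_def by (auto split: if_splits simp: of_bool_def)
    then show ?thesis using a' b' a0 True pw(1) by auto
  next
    case False
    then have ps: "p (Suc m) = 1" "p m = 0" using pm ph by (auto simp: one_phase_def)
    then have s: "s m" using p' by (cases "s m"; cases "r (Suc m)") auto
    have nr: "\<not> r (Suc m)" using ps ph(2) unfolding one_phase_def
      by (cases "s (Suc m)"; cases "r (Suc m)") auto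
    have qs: "q m = 0" "q (Suc m) = 0" "\<not> r m"
      using ps ph s unfolding one_phase_def
      by (cases "r m"; cases "r (Suc m)"; cases "s (Suc m)"; auto)+
    have vm: "v m = 0" using nr qs transit_state[OF v, of m] by auto
    have "excess v u m = 0"
      using pw(2)[OF ps(1)] vm by (simp add: excess_Suc)
    moreover have "int m \<le> excess u v m"
    \<comment> \<open>At time \<open>m - 1\<close> a ball arrived at the first box, which made it occupied.\<close>
    proof (cases m)
      case (Suc k)
      have "0 < u k" using s Suc transit_state[OF u, of k] by auto
      then have "int (Suc k) \<le> int (Suc k) * (int (u k) - int (v (Suc k)))"
        using vm Suc by (simp add: mult_le_cancel_left1)
      also have "\<dots> \<le> excess u v (Suc k)"
        using balancedD(1)[OF bal, of k] unfolding excess_Suc by (rule add_increasing) simp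
      finally show ?thesis using Suc by simp
    qed simp
    ultimately show ?thesis using a' b' ps qs by simp
  qed
qed

lemma balanced_transit:
  assumes bal: "balanced u v" and u: "transit s u u'" and v: "transit r v v'"
    and sr: "s 0 \<noteq> r 0"
  shows "balanced u' v'"
  unfolding balanced_def
proof
  fix m
  obtain p q where p: "waiting s r p" and q: "waiting r s q" using waiting_exists by blast
  note ph = phases_forward[OF bal u v sr p q]
  have sym: "one_phase r s q p k" for k using ph[of k] by (auto simp: one_phase_def)
  show "0 \<le> excess u' v' m \<and> 0 \<le> excess v' u' m \<and> (excess u' v' m = 0 \<or> excess v' u' m = 0)"
  proof (cases "p m = 1 \<or> p (Suc m) = 1")
    case True
    have "0 \<le> excess u' v' m \<and> excess v' u' m = 0"
      using excess_transit_forward[OF bal u v p q _ _ _ _ True] ph[of m] ph[of "Suc m"] by blast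
    then show ?thesis by simp
  next
    case np: False
    show ?thesis
    proof (cases "q m = 1 \<or> q (Suc m) = 1")
      case True
      have "0 \<le> excess v' u' m \<and> excess u' v' m = 0"
        using excess_transit_forward[OF balanced_sym[OF bal] v u q p sym sym _ _ True]
          ph[of m] ph[of "Suc m"] by blast
      then show ?thesis by simp
    next
      case False
      then have "p m = 0" "p (Suc m) = 0" "q m = 0" "q (Suc m) = 0"
        using np ph[of m] ph[of "Suc m"] by (auto simp: one_phase_def)
      then have "excess u' v' m = excess u v m" "excess v' u' m = excess v u m"
        using excess_transit[OF u v p] excess_transit[OF v u q] by simp_all
      then show ?thesis using bal by (simp add: balanced_def)
    qed
  qed
qed

text \<open>Once both boxes stay empty, \<open>p\<close> is constant and the excess grows by this constant,
  which is \<open>0\<close> or \<open>1\<close>.\<close>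

lemma excess_transit_eventually_mono:
  assumes bal: "balanced u v" and u: "transit s u u'" and v: "transit r v v'"
    and sr: "s 0 \<noteq> r 0" and fin: "\<not> s m" "\<not> r (Suc m)"
  shows "excess u v m \<le> excess u' v' m"
proof -
  obtain p q where p: "waiting s r p" and q: "waiting r s q" using waiting_exists by blast
  have "p (Suc m) = p m" using waiting_Suc[OF p, of m] fin by simp
  moreover have "0 \<le> p m"
    using phases_forward[OF bal u v sr p q, of m] by (auto simp: one_phase_def)
  ultimately show ?thesis
    using excess_transit[OF u v p, of m] by (simp add: algebra_simps)
qed


text \<open>The mirror image of the forward step. Going back in time from a moment at which the first
  box is occupied or awaited, \<open>excess v' u'\<close> stays positive as long as \<open>v'\<close> vanishes. Hence
  \<open>excess u' v'\<close> and with it \<open>u'\<close> vanish meanwhile, so that the first box stays empty until the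
  second one is found occupied.\<close>

lemma phase_step_back:
  fixes p q :: "nat \<Rightarrow> int"
  assumes bal: "balanced u' v'" and u: "transit s u u'" and v: "transit r v v'"
    and p: "p (Suc m) = p m + of_bool (s m) - of_bool (r (Suc m))"
    and q: "q (Suc m) = q m + of_bool (r m) - of_bool (s (Suc m))"
    and act: "s (Suc m) \<or> q (Suc m) = 1" "\<not> r (Suc m)" "p (Suc m) = 0"
      "\<not> s (Suc m) \<or> q (Suc m) = 0"
    and w: "q (Suc m) = 1 \<Longrightarrow> v' (Suc m) = 0 \<and> 0 < excess v' u' (Suc m)"
  shows "\<not> s m \<and> p m = 0 \<and> q m = 1 - of_bool (r m) \<and>
    (\<not> r m \<longrightarrow> v' m = 0 \<and> 0 < excess v' u' m)"
proof -
  have b: "excess v' u' (Suc m) = excess v' u' m + int (Suc m) * (int (v' m) - int (u' (Suc m)))"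
    by (rule excess_Suc)
  have ns: "\<not> s m"
  proof (cases "s (Suc m)")
    case True
    then show ?thesis using transit_state_back[OF u, of m] by blast
  next
    case False
    then have z: "v' (Suc m) = 0" "0 < excess v' u' (Suc m)" using act w by blast+
    then have "excess u' v' (Suc m) = 0" using balancedD(3)[OF balanced_sym[OF bal]] by blast
    then have "excess u' v' m + int (Suc m) * int (u' m) = 0" using z by (simp add: excess_Suc)
    moreover have "0 \<le> int (Suc m) * int (u' m)" by simp
    ultimately have "int (Suc m) * int (u' m) = 0" using balancedD(1)[OF bal, of m] by linarith
    then have "u' m = 0" by simp
    then show ?thesis using transit_state_back[OF u, of m] by simp
  qed
  moreover have "v' m = 0 \<and> 0 < excess v' u' m" if nr: "\<not> r m"
  proof -
    have vm: "v' m = 0" using nr act(2) transit_state_back[OF v, of m] by simp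
    have "0 < int (u' (Suc m)) \<or> 0 < excess v' u' (Suc m)"
      using act(1) w transit_state_back[OF u, of "Suc m"] by auto
    then have "0 < int (Suc m) * int (u' (Suc m)) \<or> 0 < excess v' u' (Suc m)"
      using mult_pos_pos[of "int (Suc m)" "int (u' (Suc m))"] by linarith
    moreover have "0 \<le> int (Suc m) * int (u' (Suc m))" by simp
    moreover have "excess v' u' m = excess v' u' (Suc m) + int (Suc m) * int (u' (Suc m))"
      using b vm by simp
    ultimately have "0 < excess v' u' m" using balancedD(2)[OF bal, of "Suc m"] by linarith
    then show ?thesis using vm by blast
  qed
  moreover have "p m = 0" "q m = 1 - of_bool (r m)"
    using p q act ns by auto
  ultimately show ?thesis by blast
qed

text \<open>At the end of time both boxes are empty, and the positive one among the two excesses tells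
  which box is awaited. From there the phases are traced back to time \<open>0\<close>, where no wait is
  possible, because a wait makes an excess positive but at \<open>0\<close> both excesses are zero. So one of the
  boxes is occupied at time \<open>0\<close>.\<close>

lemma phases_backward:
  assumes bal: "balanced u' v'" and u: "transit s u u'" and v: "transit r v v'"
    and fin: "\<forall>k\<ge>N. \<not> s k \<and> u' k = 0" "\<forall>k\<ge>N. \<not> r k \<and> v' k = 0"
    and pos: "0 < (\<Sum>k<N. u' k + v' k)"
  obtains p q where "waiting s r p" "waiting r s q"
    "\<And>m. one_phase s r p q m"
    "\<And>m. p m = 1 \<Longrightarrow> u' m = 0 \<and> 0 < excess u' v' m"
    "\<And>m. q m = 1 \<Longrightarrow> v' m = 0 \<and> 0 < excess v' u' m"
proof -
  \<comment> \<open>\<open>P\<close> is the final value of \<open>p\<close>; the recursions for \<open>p\<close> and \<open>q\<close> are solved downwards from \<open>N\<close>.\<close>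
  define P where "P = (of_bool (0 < excess u' v' N) :: int)"
  define p where "p m = P - (\<Sum>k\<in>{m..<N}. of_bool (s k) - of_bool (r (Suc k)))" for m
  define q where "q m = (1 - P) - (\<Sum>k\<in>{m..<N}. of_bool (r k) - of_bool (s (Suc k)))" for m
  have p_Suc: "p (Suc m) = p m + of_bool (s m) - of_bool (r (Suc m))" for m
    unfolding p_def using fin by (cases "m < N") (simp_all add: sum.atLeast_Suc_lessThan)
  have q_Suc: "q (Suc m) = q m + of_bool (r m) - of_bool (s (Suc m))" for m
    unfolding q_def using fin by (cases "m < N") (simp_all add: sum.atLeast_Suc_lessThan)
  have const: "excess u' v' m = excess u' v' N \<and> excess v' u' m = excess v' u' N" if "N \<le> m" for m
    using that by (induction m rule: dec_induct) (use fin in \<open>auto simp: excess_Suc\<close>)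
  have tot: "0 < excess u' v' N + excess v' u' N"
  proof -
    have "0 < int (\<Sum>k<N. u' k + v' k)" using pos by linarith
    also have "\<dots> = (\<Sum>k<N. int (u' k) + int (v' k))" by simp
    also have "\<dots> = excess u' v' N + excess v' u' N"
      using excess_add_swap[of u' v' N] fin by simp
    finally show ?thesis .
  qed
  define good where "good m \<longleftrightarrow> one_phase s r p q m
      \<and> (p m = 1 \<longrightarrow> u' m = 0 \<and> 0 < excess u' v' m)
      \<and> (q m = 1 \<longrightarrow> v' m = 0 \<and> 0 < excess v' u' m)" for m
  \<comment> \<open>A constant positive excess from \<open>N\<close> on gives the invariant for the final wait.\<close>
  have tail: "good m" if "N \<le> m" for m
    using that const[OF that] fin tot balancedD[OF bal, of N]
    by (auto simp: good_def one_phase_def p_def q_def P_def)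
  have backstep: "good m" if g: "good (Suc m)" for m
  proof -
    from g have "one_phase s r p q (Suc m)" by (simp add: good_def)
    then show ?thesis
    proof (cases rule: one_phase_cases_back)
      case 1
      have "\<not> s m \<and> p m = 0 \<and> q m = 1 - of_bool (r m) \<and>
          (\<not> r m \<longrightarrow> v' m = 0 \<and> 0 < excess v' u' m)"
        by (rule phase_step_back[OF bal u v p_Suc q_Suc 1]) (use g in \<open>simp add: good_def\<close>)
      then show ?thesis by (auto simp: good_def one_phase_def)
    next
      case 2
      have "\<not> r m \<and> q m = 0 \<and> p m = 1 - of_bool (s m) \<and>
          (\<not> s m \<longrightarrow> u' m = 0 \<and> 0 < excess u' v' m)"
        by (rule phase_step_back[OF balanced_sym[OF bal] v u q_Suc p_Suc 2])
          (use g in \<open>simp add: good_def\<close>)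
      then show ?thesis by (auto simp: good_def one_phase_def)
    qed
  qed
  have all: "good m" for m
  proof (cases "N \<le> m")
    case False
    then have "m \<le> N" by simp
    then show ?thesis
      by (induction rule: inc_induct) (use tail backstep in auto)
  qed (rule tail)
  have "p 0 \<noteq> 1" "q 0 \<noteq> 1" using all[of 0] by (auto simp: good_def)
  then have "p 0 = 0" "q 0 = 0" using all[of 0] by (auto simp: good_def one_phase_def)
  then show ?thesis
    using that[of p q] p_Suc q_Suc all by (simp add: waiting_def good_def)
qed

lemma excess_transit_backward:
  assumes bal: "balanced u' v'" and u: "transit s u u'" and v: "transit r v v'"
    and p: "waiting s r p" and q: "waiting r s q"
    and ph: "one_phase s r p q m" "one_phase s r p q (Suc m)"
    and pw: "p m = 1 \<Longrightarrow> u' m = 0 \<and> 0 < excess u' v' m"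
      "p (Suc m) = 1 \<Longrightarrow> u' (Suc m) = 0 \<and> 0 < excess u' v' (Suc m)"
    and pm: "p m = 1 \<or> p (Suc m) = 1"
  shows "0 \<le> excess u v m \<and> excess v u m = 0"
proof -
  note p' = waiting_Suc[OF p, of m] and q' = waiting_Suc[OF q, of m]
  have a': "excess u' v' m = excess u v m + int (Suc m) * p m - int m * p (Suc m)"
    and b': "excess v' u' m = excess v u m + int (Suc m) * q m - int m * q (Suc m)"
    using excess_transit[OF u v p] excess_transit[OF v u q] by blast+
  show ?thesis
  proof (cases "p m = 1")
    case True
    have qs: "\<not> s m" "q m = 0" "q (Suc m) = 0"
      using True ph q' unfolding one_phase_def
      by (cases "s m"; cases "r m"; cases "s (Suc m)"; auto)+
    then have b: "excess v u m = 0" using b' balancedD(3)[OF bal] pw(1)[OF True] by simp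
    show ?thesis
    proof (cases "r (Suc m)")
      case False
      then have "p (Suc m) = 1" using p' qs True by simp
      then show ?thesis using True a' b pw(1) by simp
    next
      case r: True
      then have "p (Suc m) = 0" using p' qs True by simp
      moreover have "int (Suc m) \<le> excess u' v' m"
      proof -
        have "1 \<le> int (v' (Suc m))" using r transit_state_back[OF v, of "Suc m"] by simp
        then have "int (Suc m) \<le> int (Suc m) * int (v' (Suc m))"
          by (simp add: mult_le_cancel_left1)
        moreover have "excess u' v' (Suc m) = excess u' v' m - int (Suc m) * int (v' (Suc m))"
          using pw(1)[OF True] by (simp add: excess_Suc)
        ultimately show ?thesis using balancedD(1)[OF bal, of "Suc m"] by linarith
      qed
      ultimately show ?thesis using True a' b by simp
    qed
  next
    case False
    then have ps: "p (Suc m) = 1" "p m = 0" using pm ph by (auto simp: one_phase_def)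
    then have s: "s m" using p' by (cases "s m"; cases "r (Suc m)") auto
    have qs: "q m = 0" "q (Suc m) = 0"
      using ps ph s unfolding one_phase_def
      by (cases "r m"; cases "r (Suc m)"; cases "s (Suc m)"; auto)+
    have "excess v' u' (Suc m) = 0" using balancedD(3)[OF bal] pw(2)[OF ps(1)] by blast
    then have "excess v' u' m + int (Suc m) * int (v' m) = 0"
      using pw(2)[OF ps(1)] by (simp add: excess_Suc)
    moreover have "0 \<le> int (Suc m) * int (v' m)" by simp
    ultimately have "excess v' u' m = 0" using balancedD(2)[OF bal, of m] by linarith
    then show ?thesis using a' b' ps qs balancedD(1)[OF bal, of m] by simp
  qed
qed

text \<open>The states at time \<open>0\<close> are the results of the backward run. That they differ says that each
  position belongs to exactly one of the two subsets that are being reconstructed.\<close>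

lemma balanced_transit_back:
  assumes bal: "balanced u' v'" and u: "transit s u u'" and v: "transit r v v'"
    and fin: "\<forall>k\<ge>N. \<not> s k \<and> u' k = 0" "\<forall>k\<ge>N. \<not> r k \<and> v' k = 0"
    and pos: "0 < (\<Sum>k<N. u' k + v' k)"
  shows "s 0 \<noteq> r 0" and "balanced u v"
proof -
  obtain p q where p: "waiting s r p" and q: "waiting r s q"
    and ph: "\<And>m. one_phase s r p q m"
    and pw: "\<And>m. p m = 1 \<Longrightarrow> u' m = 0 \<and> 0 < excess u' v' m"
    and qw: "\<And>m. q m = 1 \<Longrightarrow> v' m = 0 \<and> 0 < excess v' u' m"
    by (rule phases_backward[OF bal u v fin pos]) blast
  show "s 0 \<noteq> r 0"
    using ph[of 0] waiting_0[OF p] waiting_0[OF q] unfolding one_phase_def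
    by (cases "s 0"; cases "r 0") auto
  have sym: "one_phase r s q p k" for k using ph[of k] by (auto simp: one_phase_def)
  show "balanced u v"
    unfolding balanced_def
  proof
    fix m
    show "0 \<le> excess u v m \<and> 0 \<le> excess v u m \<and> (excess u v m = 0 \<or> excess v u m = 0)"
    proof (cases "p m = 1 \<or> p (Suc m) = 1")
      case True
      show ?thesis using excess_transit_backward[OF bal u v p q ph ph pw pw True] by simp
    next
      case np: False
      show ?thesis
      proof (cases "q m = 1 \<or> q (Suc m) = 1")
        case True
        show ?thesis
          using excess_transit_backward[OF balanced_sym[OF bal] v u q p sym sym qw qw True] by simp
      next
        case False
        then have "p m = 0" "p (Suc m) = 0" "q m = 0" "q (Suc m) = 0"
          using np ph[of m] ph[of "Suc m"] by (auto simp: one_phase_def)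
        then have "excess u' v' m = excess u v m" "excess v' u' m = excess v u m"
          using excess_transit[OF u v p] excess_transit[OF v u q] by simp_all
        then show ?thesis using bal unfolding balanced_def by metis
      qed
    qed
  qed
qed

section \<open>Balanced pairs and complementary words\<close>

lemma balanced_words: "balanced (flux (col_of bs)) (flux (col_of (map Not bs)))"
proof (induction bs)
  case Nil
  show ?case by (simp add: balanced_def excess_def)
next
  case (Cons b bs)
  obtain s r where "s 0 = b" "transit s (flux (col_of bs)) (flux (col_of (b # bs)))"
    "r 0 = (\<not> b)" "transit r (flux (col_of (map Not bs))) (flux (col_of ((\<not> b) # map Not bs)))"
    using flux_col_of_Cons by metis
  then show ?case using balanced_transit[OF Cons.IH] by fastforce
qed

text \<open>Each backward step of the two transducers removes one row from the two partitions together,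
  since exactly one of the states at time \<open>0\<close> is occupied. So \<open>n\<close> steps empty both.\<close>

lemma words_of_balanced:
  assumes "balanced u v" "\<forall>k\<ge>N. u k = 0" "\<forall>k\<ge>N. v k = 0" "(\<Sum>k<N. u k + v k) = n"
  shows "\<exists>bs. length bs = n \<and> u = flux (col_of bs) \<and> v = flux (col_of (map Not bs))"
  using assms
proof (induction n arbitrary: u v)
  case 0
  have "u k = 0 \<and> v k = 0" for k
    using 0 by (cases "k < N") auto
  then have "u = flux (col_of [])" "v = flux (col_of (map Not []))" by auto
  then show ?case by (intro exI[of _ "[]"]) simp
next
  case (Suc n)
  obtain s u0 where s: "transit s u0 u" "\<forall>k\<ge>N. \<not> s k \<and> u0 k = 0"
    using transit_back_exists[OF Suc.prems(2)] by blast
  obtain r v0 where r: "transit r v0 v" "\<forall>k\<ge>N. \<not> r k \<and> v0 k = 0"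
    using transit_back_exists[OF Suc.prems(3)] by blast
  have sr: "s 0 \<noteq> r 0" and bal: "balanced u0 v0"
    using balanced_transit_back[OF Suc.prems(1) s(1) r(1), of N] s r Suc.prems by auto
  have "int (Suc n) = (\<Sum>k<N. int (u k)) + (\<Sum>k<N. int (v k))"
    unfolding Suc.prems(4)[symmetric] by (simp add: sum.distrib)
  also have "\<dots> = int (\<Sum>k<N. u0 k + v0 k) + 1"
    unfolding transit_sum[OF s(1)] transit_sum[OF r(1)]
    using sr s(2) r(2) by (cases "s 0") (auto simp: sum.distrib)
  finally have "(\<Sum>k<N. u0 k + v0 k) = n" by linarith
  then obtain bs where bs: "length bs = n" "u0 = flux (col_of bs)" "v0 = flux (col_of (map Not bs))"
    using Suc.IH[OF bal] s(2) r(2) by blast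
  obtain s' where s': "s' 0 = s 0" "transit s' u0 (flux (col_of (s 0 # bs)))"
    using flux_col_of_Cons[of "s 0" bs] bs(2) by metis
  obtain r' where r': "r' 0 = r 0" "transit r' v0 (flux (col_of (r 0 # map Not bs)))"
    using flux_col_of_Cons[of "r 0" "map Not bs"] bs(3) by metis
  have "u = flux (col_of (s 0 # bs))"
    by (rule transit_deterministic[OF s(1) s'(2) s'(1)[symmetric]])
  moreover have "v = flux (col_of (map Not (s 0 # bs)))"
    using transit_deterministic[OF r(1) r'(2) r'(1)[symmetric]] sr by simp
  ultimately show ?case using bs(1) by (intro exI[of _ "s 0 # bs"]) simp
qed

section \<open>From sequences back to partitions\<close>

text \<open>Row multiplicities indexed from \<open>0\<close>, so that they match the flux.\<close>

definition row_mults :: "partition \<Rightarrow> nat \<Rightarrow> nat" where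
  "row_mults lam k = rows_of_length lam (Suc k)"

lemma row_mults_shape: "row_mults (shape C) = flux C"
  by (rule ext) (simp add: row_mults_def rows_of_length_shape)

lemma row_mults_eq_0: "sum_list lam \<le> k \<Longrightarrow> row_mults lam k = 0"
  using member_le_sum_list[of "Suc k" lam]
  by (auto simp: row_mults_def rows_of_length_def count_list_0_iff)

lemma sum_row_mults:
  assumes "is_partition lam" "sum_list lam \<le> m"
  shows "(\<Sum>k<m. row_mults lam k * f (Suc k)) = sum_list (map f lam)"
proof -
  have "sum_list (map f lam) = (\<Sum>x\<in>set lam. count_list lam x * f x)"
    by (rule sum_list_map_eq_sum_count)
  also have "\<dots> = (\<Sum>x\<in>Suc ` {..<m}. count_list lam x * f x)"
  proof (rule sum.mono_neutral_left)
    show "set lam \<subseteq> Suc ` {..<m}"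
    proof
      fix x
      assume x: "x \<in> set lam"
      then have "0 < x" "x \<le> m"
        using assms member_le_sum_list[OF x] by (auto simp: is_partition_def)
      then show "x \<in> Suc ` {..<m}" by (cases x) auto
    qed
  qed (auto simp: count_list_0_iff)
  also have "\<dots> = (\<Sum>k<m. row_mults lam k * f (Suc k))"
    by (simp add: sum.reindex row_mults_def rows_of_length_def)
  finally show ?thesis ..
qed

lemma partition_eqI:
  assumes "is_partition lam" "is_partition mu" "row_mults lam = row_mults mu"
  shows "lam = mu"
proof -
  have "count_list lam x = count_list mu x" for x
  proof (cases x)
    case 0
    then have "x \<notin> set lam" "x \<notin> set mu" using assms by (auto simp: is_partition_def)
    then show ?thesis by (simp add: count_list_0_iff)
  next
    case (Suc k)
    then show ?thesis using fun_cong[OF assms(3), of k] by (simp add: row_mults_def rows_of_length_def)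
  qed
  then have "mset (rev lam) = mset (rev mu)" by (simp add: multiset_eq_iff count_mset)
  moreover have "sorted (rev lam)" "sorted (rev mu)"
    using assms by (auto simp: is_partition_def sorted_wrt_rev)
  ultimately have "rev lam = rev mu"
    by (metis properties_for_sort)
  then show ?thesis by simp
qed

lemma partition_is_shape:
  assumes "is_partition lam"
  obtains bs where "lam = shape (col_of bs)"
proof -
  obtain bs where "row_mults lam = flux (col_of bs)"
    using word_of_flux[of "sum_list lam" "row_mults lam"] row_mults_eq_0 by blast
  then have "lam = shape (col_of bs)"
    by (intro partition_eqI assms is_partition_shape) (simp add: row_mults_shape)
  then show ?thesis by (rule that)
qed

lemma shift_sum_eq_excess: "shift_sum m mu lam = - excess (row_mults lam) (row_mults mu) m"
proof -
  have "shift_sum m mu lam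
      = (\<Sum>k<m. int (Suc k) * (int (row_mults mu (Suc k)) - int (row_mults lam k)))"
    unfolding shift_sum_def row_mults_def by (simp add: sum.atLeast1_atMost_eq)
  also have "\<dots> = - excess (row_mults lam) (row_mults mu) m"
    unfolding excess_def sum_negf[symmetric]
    by (rule sum.cong) (simp_all add: algebra_simps)
  finally show ?thesis .
qed

lemma excess_row_mults:
  assumes "is_partition lam" "is_partition mu" "sum_list lam \<le> m" "sum_list mu \<le> m"
  shows "excess (row_mults lam) (row_mults mu) m
    = int (sum_list lam) - int (sum_list mu) + int (length mu)"
proof -
  have "(\<Sum>k<m. Suc k * row_mults lam k) = sum_list lam"
    using sum_row_mults[OF assms(1,3), of "\<lambda>x. x"] by (simp add: mult.commute)
  moreover have "(\<Sum>k<m. Suc k * row_mults mu (Suc k)) = sum_list (map (\<lambda>x. x - 1) mu)"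
  proof -
    have "(\<Sum>k<Suc m. row_mults mu k * (Suc k - 1)) = sum_list (map (\<lambda>x. x - 1) mu)"
      using sum_row_mults[OF assms(2), of "Suc m" "\<lambda>x. x - 1"] assms(4) by simp
    then show ?thesis by (subst (asm) sum.lessThan_Suc_shift) (simp add: mult.commute)
  qed
  moreover have "sum_list (map (\<lambda>x. x - 1) mu) + length mu = sum_list mu"
    using assms(2) unfolding is_partition_def by (induction mu) auto
  moreover have "excess (row_mults lam) (row_mults mu) m
      = int (\<Sum>k<m. Suc k * row_mults lam k) - int (\<Sum>k<m. Suc k * row_mults mu (Suc k))"
    unfolding excess_def of_nat_sum sum_subtractf[symmetric]
    by (rule sum.cong) (simp_all add: algebra_simps)
  ultimately show ?thesis by linarith
qed

lemma sum_flux: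
  assumes "sum_list (shape C) \<le> m"
  shows "(\<Sum>k<m. flux C k) = length C"
  using sum_row_mults[OF is_partition_shape assms, of "\<lambda>_. 1"]
  by (simp add: row_mults_shape map_replicate_const sum_list_replicate)

lemma excess_words_sum:
  assumes "sum_list (shape (col_of bs)) \<le> m" "sum_list (shape (col_of (map Not bs))) \<le> m"
  shows "excess (flux (col_of bs)) (flux (col_of (map Not bs))) m
    + excess (flux (col_of (map Not bs))) (flux (col_of bs)) m = int (length bs)"
proof -
  have "flux (col_of bs) m = 0" "flux (col_of (map Not bs)) m = 0"
    using row_mults_eq_0 assms by (simp_all flip: row_mults_shape)
  moreover have
    "(\<Sum>k<m. int (flux (col_of bs) k) + int (flux (col_of (map Not bs)) k)) = int (length bs)"
    using sum_flux[OF assms(1)] sum_flux[OF assms(2)] length_col_of_Not[of bs]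
    by (simp add: sum.distrib flip: of_nat_sum of_nat_add)
  ultimately show ?thesis by (simp add: excess_add_swap)
qed

lemma transit_eventually_idle:
  assumes "transit s u u'" "\<forall>k\<ge>N. u k = 0" "N < k"
  shows "\<not> s k"
  using assms transit_state[OF assms(1), of "k - 1"] by auto

text \<open>The two limits add up to the length of the word, and one of them is zero. A new first position
  never decreases either of them, so the one that is positive for the last letter alone, which
  is the letter of the largest position, remains the positive one.\<close>

lemma excess_words_limit:
  "\<exists>N. \<forall>m\<ge>N. excess (flux (col_of bs)) (flux (col_of (map Not bs))) m
    = (if bs \<noteq> [] \<and> last bs then int (length bs) else 0)"
proof (induction bs)
  case Nil
  show ?case by (simp add: excess_def)
next
  case (Cons b bs)
  let ?u = "flux (col_of bs)" and ?v = "flux (col_of (map Not bs))"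
  let ?u' = "flux (col_of (b # bs))" and ?v' = "flux (col_of (map Not (b # bs)))"
  let ?K = "sum_list (shape (col_of bs)) + sum_list (shape (col_of (map Not bs)))"
  let ?K' = "sum_list (shape (col_of (b # bs))) + sum_list (shape (col_of (map Not (b # bs))))"
  have bal: "balanced ?u ?v" and bal': "balanced ?u' ?v'" using balanced_words by blast+
  have tot': "excess ?u' ?v' m + excess ?v' ?u' m = int (length (b # bs))" if "?K' \<le> m" for m
    by (rule excess_words_sum) (use that in linarith)+
  show ?case
  proof (cases "bs = []")
    case True
    \<comment> \<open>A single ball at position \<open>1\<close> leaves in the first step.\<close>
    have one: "flux [Suc 0] (Suc k) = 0" for k
      using calc_next_col_shift_col[OF column_Nil, of True]
      by (simp add: flux_def col_seq_Suc' shift_col_def)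
    have "excess ?u' ?v' m = 0" if "\<not> b" for m
      using that True one by (simp add: excess_def shift_col_def)
    moreover have "excess ?v' ?u' m = 0" if "b" for m
      using that True one by (simp add: excess_def shift_col_def)
    ultimately show ?thesis using tot' True by (intro exI[of _ ?K']) fastforce
  next
    case False
    obtain s where s: "s 0 = b" "transit s ?u ?u'" using flux_col_of_Cons by blast
    obtain r where r: "r 0 = (\<not> b)" "transit r ?v ?v'"
      using flux_col_of_Cons[of "\<not> b" "map Not bs"] by auto
    have fin: "\<forall>k\<ge>?K. ?u k = 0" "\<forall>k\<ge>?K. ?v k = 0"
      using row_mults_eq_0 by (simp_all flip: row_mults_shape)
    obtain N where N: "excess ?u ?v m = (if bs \<noteq> [] \<and> last bs then int (length bs) else 0)"
      if "N \<le> m" for m using Cons.IH by blast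
    have "excess ?u' ?v' m = (if last bs then int (length (b # bs)) else 0)"
      if m: "N + ?K + ?K' < m" for m
    proof -
      have idle: "\<not> s m" "\<not> s (Suc m)" "\<not> r m" "\<not> r (Suc m)"
        using transit_eventually_idle[OF s(2) fin(1)] transit_eventually_idle[OF r(2) fin(2)] m by auto
      have le: "excess ?u ?v m \<le> excess ?u' ?v' m" "excess ?v ?u m \<le> excess ?v' ?u' m"
        using excess_transit_eventually_mono[OF bal s(2) r(2)]
          excess_transit_eventually_mono[OF balanced_sym[OF bal] r(2) s(2)] s(1) r(1) idle by auto
      have tot: "excess ?u ?v m + excess ?v ?u m = int (length bs)"
        by (rule excess_words_sum) (use m in linarith)+
      have pos: "0 < int (length bs)" using False by simp
      show ?thesis
      proof (cases "last bs")
        case True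
        then have "excess ?u ?v m = int (length bs)" using N[of m] m False by simp
        then have "0 < excess ?u' ?v' m" using le(1) pos by linarith
        then have "excess ?v' ?u' m = 0" by (rule balancedD(3)[OF bal'])
        then show ?thesis using tot'[of m] m True by simp
      next
        case l: False
        then have "excess ?u ?v m = 0" using N[of m] m by simp
        then have "0 < excess ?v' ?u' m" using le(2) pos tot by linarith
        then have "excess ?u' ?v' m = 0" by (rule balancedD(3)[OF balanced_sym[OF bal']])
        then show ?thesis using l by simp
      qed
    qed
    then show ?thesis using False by (intro exI[of _ "Suc (N + ?K + ?K')"]) auto
  qed
qed

lemma wt_label_col_of:
  "wt_label (shape (col_of bs)) \<le> length bs"
  "wt_label (shape (col_of bs)) = length bs \<longleftrightarrow> bs = [] \<or> last bs"
proof -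
  let ?w = "length bs"
  have wt: "wt_label (shape (col_of bs)) = Max (insert 0 (set (col_of bs)))"
    by (rule wt_label_shape_Max) simp
  then show le: "wt_label (shape (col_of bs)) \<le> ?w" by (auto simp: in_set_col_of)
  have "wt_label (shape (col_of bs)) = ?w \<longleftrightarrow> ?w \<in> insert 0 (set (col_of bs))"
    using le unfolding wt
    by (metis List.finite_set Max_ge Max_in empty_not_insert finite.insertI le_antisym)
  then show "wt_label (shape (col_of bs)) = ?w \<longleftrightarrow> bs = [] \<or> last bs"
    by (auto simp: in_set_col_of last_conv_nth)
qed

lemma orth_col_of: "orth (length bs) (shape (col_of bs)) = shape (col_of (map Not bs))"
  using orth_shape[OF column_col_of wt_label_col_of(1)] by (simp add: complement_col_of)

lemma partition_word:
  assumes "is_partition lam" "wt_label lam \<le> w"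
  obtains bs where "length bs = w" "lam = shape (col_of bs)"
proof -
  obtain bs where lam: "lam = shape (col_of bs)" by (rule partition_is_shape[OF assms(1)])
  have "set (col_of bs) \<subseteq> {1..w}"
    using assms(2) wt_label_shape_Max[OF column_col_of, of bs] lam by (auto simp: in_set_col_of)
  then show ?thesis using that lam column_word[OF column_col_of] by metis
qed

text \<open>The size formula evaluates the limit of the excess: in the limit the excess is the difference
  of the number of boxes of the first partition and the number of boxes of the second outside
  its first column.\<close>

lemma orth_properties:
  assumes "is_partition lam" "wt_label lam \<le> w"
  shows "is_partition (orth w lam)"
    and "length lam + length (orth w lam) = w"
    and "balanced (row_mults lam) (row_mults (orth w lam))"
    and "sum_list lam + length (orth w lam)
      = sum_list (orth w lam) + (if wt_label lam = w then w else 0)"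
proof -
  obtain bs where bs: "length bs = w" "lam = shape (col_of bs)" using partition_word[OF assms] .
  have orth: "orth w lam = shape (col_of (map Not bs))" using orth_col_of[of bs] bs by simp
  show part: "is_partition (orth w lam)" unfolding orth by (rule is_partition_shape)
  show "length lam + length (orth w lam) = w"
    unfolding orth unfolding bs(2) length_shape using bs(1) length_col_of_Not[of bs] by simp
  show "balanced (row_mults lam) (row_mults (orth w lam))"
    unfolding orth unfolding bs(2) row_mults_shape by (rule balanced_words)
  obtain N where N: "\<forall>m\<ge>N. excess (row_mults lam) (row_mults (orth w lam)) m
      = (if bs \<noteq> [] \<and> last bs then int (length bs) else 0)"
    using excess_words_limit[of bs] unfolding orth unfolding bs(2) row_mults_shape by blast
  have "int (sum_list lam) - int (sum_list (orth w lam)) + int (length (orth w lam))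
      = (if bs \<noteq> [] \<and> last bs then int (length bs) else 0)"
    using N excess_row_mults[OF assms(1) part, of "N + sum_list lam + sum_list (orth w lam)"]
    by simp
  also have "\<dots> = (if wt_label lam = w then int w else 0)"
    using wt_label_col_of(2)[of bs] bs by auto
  finally have "int (sum_list lam) + int (length (orth w lam))
      = int (sum_list (orth w lam)) + (if wt_label lam = w then int w else 0)"
    by simp
  then show "sum_list lam + length (orth w lam)
      = sum_list (orth w lam) + (if wt_label lam = w then w else 0)"
    by (simp split: if_splits)
qed

lemma orth_unique:
  assumes lam: "is_partition lam" and mu: "is_partition mu"
    and bal: "balanced (row_mults lam) (row_mults mu)"
  shows "wt_label lam \<le> length lam + length mu \<and> mu = orth (length lam + length mu) lam"
proof -
  let ?N = "sum_list lam + sum_list mu"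
  have "(\<Sum>k<?N. row_mults lam k + row_mults mu k) = length lam + length mu"
    using sum_row_mults[OF lam, of ?N "\<lambda>_. 1"] sum_row_mults[OF mu, of ?N "\<lambda>_. 1"]
    by (simp add: sum.distrib map_replicate_const sum_list_replicate)
  moreover have "\<forall>k\<ge>?N. row_mults lam k = 0" "\<forall>k\<ge>?N. row_mults mu k = 0"
    using row_mults_eq_0 by auto
  ultimately obtain bs where bs: "length bs = length lam + length mu"
    "row_mults lam = row_mults (shape (col_of bs))"
    "row_mults mu = row_mults (shape (col_of (map Not bs)))"
    using words_of_balanced[OF bal] unfolding row_mults_shape by blast
  have "lam = shape (col_of bs)" "mu = shape (col_of (map Not bs))"
    using bs lam mu is_partition_shape by (blast intro: partition_eqI)+
  then show ?thesis using wt_label_col_of(1)[of bs] orth_col_of[of bs] bs(1) by simp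
qed

section \<open>Affine MV polytopes and the formula for the partner\<close>

lemma scale_roots:
  "scale n (alpha1_root k) = (n * (k - 1), n * k)" "scale n (alpha0_root k) = (n * k, n * (k - 1))"
  "scale n delta = (n, n)"
  by (simp_all add: scale_def alpha1_root_def alpha0_root_def alpha0_def alpha1_def delta_def)

lemma sum_list_minus_one:
  "is_partition lam \<Longrightarrow> sum_list (map (\<lambda>x. x - 1) lam) + length lam = sum_list lam"
  unfolding is_partition_def by (induction lam) auto

text \<open>The total size is symmetric in the two real parts. The two coefficients of the weight are
  smaller by the numbers of rows, since a row of length \<open>k\<close> contributes \<open>k\<close> to one of
  them and \<open>k - 1\<close> to the other.\<close>

definition total :: "partition_triple \<Rightarrow> nat" where
  "total \<pi> = sum_list (part1 \<pi>) + sum_list (part_delta \<pi>) + sum_list (part0 \<pi>)"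

lemma weight_total:
  assumes "is_partition (part1 \<pi>)" "is_partition (part0 \<pi>)"
  shows "fst (weight \<pi>) + length (part1 \<pi>) = total \<pi>"
    and "snd (weight \<pi>) + length (part0 \<pi>) = total \<pi>"
proof -
  have rows: "(\<Sum>k\<in>set lam. rows_of_length lam k * f k) = sum_list (map f lam)"
    for lam :: partition and f :: "nat \<Rightarrow> nat"
    by (simp add: rows_of_length_def sum_list_map_eq_sum_count)
  have "fst (weight \<pi>) = sum_list (map (\<lambda>x. x - 1) (part1 \<pi>))
      + sum_list (part_delta \<pi>) + sum_list (part0 \<pi>)"
    using rows[of "part1 \<pi>" "\<lambda>x. x - 1"] rows[of "part0 \<pi>" "\<lambda>x. x"]
    by (simp add: weight_def fst_sum scale_roots)
  then show "fst (weight \<pi>) + length (part1 \<pi>) = total \<pi>"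
    using sum_list_minus_one[OF assms(1)] by (simp add: total_def)
  have "snd (weight \<pi>) = sum_list (part1 \<pi>) + sum_list (part_delta \<pi>)
      + sum_list (map (\<lambda>x. x - 1) (part0 \<pi>))"
    using rows[of "part0 \<pi>" "\<lambda>x. x - 1"] rows[of "part1 \<pi>" "\<lambda>x. x"]
    by (simp add: weight_def snd_sum scale_roots)
  then show "snd (weight \<pi>) + length (part0 \<pi>) = total \<pi>"
    using sum_list_minus_one[OF assms(2)] by (simp add: total_def)
qed

lemma affine_MV_iff_balanced:
  "affine_MV \<pi> \<phi> \<longleftrightarrow>
     balanced (row_mults (part1 \<pi>)) (row_mults (part0 \<phi>)) \<and>
     balanced (row_mults (part0 \<pi>)) (row_mults (part1 \<phi>)) \<and>
     first_part (part_delta \<pi>) \<le> length (part1 \<pi>) + length (part0 \<phi>) \<and>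
     length (part1 \<pi>) + length (part0 \<phi>) = length (part0 \<pi>) + length (part1 \<phi>) \<and>
     part_delta \<phi> =
       (if sum_list (part_delta \<pi>) = sum_list (part_delta \<phi>) then part_delta \<pi>
        else if sum_list (part_delta \<pi>) > sum_list (part_delta \<phi>) then tl (part_delta \<pi>)
        else add_top_row (length (part1 \<pi>) + length (part0 \<phi>)) (part_delta \<pi>))"
proof -
  have pair: "0 \<in> {- x, - y} \<and> {- x, - y} \<subseteq> {..0} \<longleftrightarrow> 0 \<le> x \<and> 0 \<le> y \<and> (x = 0 \<or> y = 0)"
    for x y :: int by auto
  have bal: "balanced u v \<longleftrightarrow> (\<forall>m\<ge>1. 0 \<in> {- excess u v m, - excess v u m}
      \<and> {- excess u v m, - excess v u m} \<subseteq> {..0})" for u v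
    unfolding balanced_def pair by (metis excess_0 less_one not_less order_refl)
  have swap: "{a, b} = {b, a}" for a b :: int by blast
  show ?thesis
    unfolding affine_MV_def bal num_rows_def c_up_def c_right_def c_down_def c_left_def
      shift_sum_eq_excess
    using swap by (smt (verit, ccfv_threshold))
qed

lemma add_top_row_partition:
  "is_partition lam \<Longrightarrow> first_part lam \<le> w \<Longrightarrow> is_partition (add_top_row w lam)"
  by (cases lam) (auto simp: is_partition_def add_top_row_def first_part_def)

lemma tl_partition: "is_partition lam \<Longrightarrow> is_partition (tl lam)"
  by (cases lam) (auto simp: is_partition_def)

lemma sum_list_add_top_row: "sum_list (add_top_row w lam) = w + sum_list lam"
  by (simp add: add_top_row_def)

lemma sum_list_tl: "first_part lam + sum_list (tl lam) = sum_list lam"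
  by (cases lam) (simp_all add: first_part_def)

definition lozenge_formula :: "partition_triple \<Rightarrow> partition_triple" where
  "lozenge_formula \<pi> = (let w = wt_triple \<pi> in
     Triple (orth w (part0 \<pi>))
      (if w = wt_label (part0 \<pi>) \<and> w = wt_label (part1 \<pi>) then add_top_row w (part_delta \<pi>)
       else if w > wt_label (part0 \<pi>) \<and> w > wt_label (part1 \<pi>) then tl (part_delta \<pi>)
       else part_delta \<pi>)
      (orth w (part1 \<pi>)))"

lemma wt_triple_eq_max:
  "wt_triple \<pi> = max (first_part (part_delta \<pi>)) (max (wt_label (part1 \<pi>)) (wt_label (part0 \<pi>)))"
  by (simp add: wt_triple_def max.commute max.left_commute)

text \<open>In both pairs of partners the total number of rows is \<open>w\<close>, and the changes of size of the real
  parts are cancelled by that of the \<open>\<delta>\<close>-part: it gains \<open>w\<close> for each of the two weight labels that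
  is equal to \<open>w\<close>, and loses \<open>w\<close> once.\<close>

lemma lozenge_formula_affine_MV:
  assumes "\<pi> \<in> root_partitions \<theta>"
  shows "lozenge_formula \<pi> \<in> root_partitions \<theta> \<and> affine_MV \<pi> (lozenge_formula \<pi>)"
proof -
  let ?w = "wt_triple \<pi>" and ?\<phi> = "lozenge_formula \<pi>" and ?\<delta> = "part_delta \<pi>"
  have part: "is_partition (part1 \<pi>)" "is_partition ?\<delta>" "is_partition (part0 \<pi>)"
    and wt: "weight \<pi> = \<theta>" using assms by (auto simp: root_partitions_def)
  have le: "wt_label (part1 \<pi>) \<le> ?w" "wt_label (part0 \<pi>) \<le> ?w" "first_part ?\<delta> \<le> ?w"
    by (simp_all add: wt_triple_eq_max)
  note o1 = orth_properties[OF part(1) le(1)] and o0 = orth_properties[OF part(3) le(2)]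
  have \<phi>: "part1 ?\<phi> = orth ?w (part0 \<pi>)" "part0 ?\<phi> = orth ?w (part1 \<pi>)"
    by (simp_all add: lozenge_formula_def Let_def)
  have \<phi>\<delta>: "part_delta ?\<phi> =
      (if ?w = wt_label (part0 \<pi>) \<and> ?w = wt_label (part1 \<pi>) then add_top_row ?w ?\<delta>
       else if ?w > wt_label (part0 \<pi>) \<and> ?w > wt_label (part1 \<pi>) then tl ?\<delta> else ?\<delta>)"
    by (simp add: lozenge_formula_def Let_def)
  have first: "first_part ?\<delta> = ?w" if "?w > wt_label (part0 \<pi>)" "?w > wt_label (part1 \<pi>)"
    using that unfolding wt_triple_eq_max by (simp add: max_def split: if_splits)
  \<comment> \<open>If neither label reaches \<open>?w\<close>, the deleted first row has length \<open>?w\<close>.\<close>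
  have size: "sum_list (part_delta ?\<phi>) + ?w = sum_list ?\<delta>
      + (if wt_label (part1 \<pi>) = ?w then ?w else 0) + (if wt_label (part0 \<pi>) = ?w then ?w else 0)"
    unfolding \<phi>\<delta> using le(1,2) first sum_list_tl[of ?\<delta>] by (auto simp: sum_list_add_top_row)
  have part\<phi>: "is_partition (part1 ?\<phi>)" "is_partition (part0 ?\<phi>)" "is_partition (part_delta ?\<phi>)"
    using o1(1) o0(1) part(2) le(3) unfolding \<phi> \<phi>\<delta>
    by (auto intro: add_top_row_partition tl_partition)
  have "total \<pi> + length (part1 ?\<phi>) = total ?\<phi> + length (part1 \<pi>)"
    "total \<pi> + length (part0 ?\<phi>) = total ?\<phi> + length (part0 \<pi>)"
    using o1(2,4) o0(2,4) size unfolding \<phi> total_def by linarith+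
  then have "weight ?\<phi> = weight \<pi>"
    using weight_total[OF part(1,3)] weight_total[OF part\<phi>(1,2)] by (intro prod_eqI) linarith+
  moreover have "affine_MV \<pi> ?\<phi>"
    unfolding affine_MV_iff_balanced
  proof (intro conjI)
    show "part_delta ?\<phi> = (if sum_list ?\<delta> = sum_list (part_delta ?\<phi>) then ?\<delta>
        else if sum_list ?\<delta> > sum_list (part_delta ?\<phi>) then tl ?\<delta>
        else add_top_row (length (part1 \<pi>) + length (part0 ?\<phi>)) ?\<delta>)"
    proof (cases "?w = 0")
      case True
      then have "wt_label (part1 \<pi>) = ?w" "wt_label (part0 \<pi>) = ?w" using le by simp_all
      then show ?thesis using True \<phi>\<delta> by (simp add: add_top_row_def)
    next
      case False
      then show ?thesis
        using le(1,2) first sum_list_tl[of ?\<delta>] o1(2) unfolding \<phi> \<phi>\<delta>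
        by (auto simp: sum_list_add_top_row)
    qed
  qed (use o1 o0 le(3) \<phi> in auto)
  ultimately show ?thesis using part\<phi> wt by (simp add: root_partitions_def)
qed

text \<open>The real parts are forced by \<open>orth_unique\<close> for the number \<open>w\<close> of rows. The equality of
  weights fixes the size of the \<open>\<delta>\<close>-part. If neither weight label reaches \<open>w\<close>, the \<open>\<delta>\<close>-part must
  lose \<open>w\<close> boxes, which is possible only if its first row has length \<open>w\<close>; so in every case \<open>w\<close>
  is the maximum that defines \<open>wt_triple\<close>.\<close>

lemma affine_MV_imp_lozenge_formula:
  assumes "\<pi> \<in> root_partitions \<theta>" "\<phi> \<in> root_partitions \<theta>" "affine_MV \<pi> \<phi>"
  shows "\<phi> = lozenge_formula \<pi>"
proof -
  let ?\<delta> = "part_delta \<pi>" and ?\<epsilon> = "part_delta \<phi>"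
  define w where "w = length (part1 \<pi>) + length (part0 \<phi>)"
  have part: "is_partition (part1 \<pi>)" "is_partition (part0 \<pi>)"
    "is_partition (part1 \<phi>)" "is_partition (part0 \<phi>)"
    and wt: "weight \<phi> = weight \<pi>" using assms(1,2) by (auto simp: root_partitions_def)
  have bal: "balanced (row_mults (part1 \<pi>)) (row_mults (part0 \<phi>))"
    "balanced (row_mults (part0 \<pi>)) (row_mults (part1 \<phi>))"
    and first: "first_part ?\<delta> \<le> w"
    and w': "length (part0 \<pi>) + length (part1 \<phi>) = w"
    and \<epsilon>: "?\<epsilon> = (if sum_list ?\<delta> = sum_list ?\<epsilon> then ?\<delta>
        else if sum_list ?\<delta> > sum_list ?\<epsilon> then tl ?\<delta> else add_top_row w ?\<delta>)"
    using assms(3) unfolding affine_MV_iff_balanced w_def by simp_all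
  have \<epsilon>_eq: "?\<epsilon> = ?\<delta>" if "sum_list ?\<epsilon> = sum_list ?\<delta>"
    by (subst \<epsilon>) (simp add: that)
  have \<epsilon>_less: "?\<epsilon> = tl ?\<delta>" if "sum_list ?\<epsilon> < sum_list ?\<delta>"
    by (subst \<epsilon>) (use that in simp)
  have \<epsilon>_more: "?\<epsilon> = add_top_row w ?\<delta>" if "sum_list ?\<delta> < sum_list ?\<epsilon>"
    by (subst \<epsilon>) (use that in simp)
  have orth: "wt_label (part1 \<pi>) \<le> w" "part0 \<phi> = orth w (part1 \<pi>)"
    "wt_label (part0 \<pi>) \<le> w" "part1 \<phi> = orth w (part0 \<pi>)"
    using orth_unique[OF part(1,4) bal(1)] orth_unique[OF part(2,3) bal(2)] w'
    unfolding w_def by simp_all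
  have "total \<pi> + length (part1 \<phi>) = total \<phi> + length (part1 \<pi>)"
    using weight_total[OF part(1,2)] weight_total[OF part(3,4)] wt by simp
  moreover have
    "sum_list (part1 \<pi>) + length (part0 \<phi>)
      = sum_list (part0 \<phi>) + (if wt_label (part1 \<pi>) = w then w else 0)"
    "sum_list (part0 \<pi>) + length (part1 \<phi>)
      = sum_list (part1 \<phi>) + (if wt_label (part0 \<pi>) = w then w else 0)"
    using orth_properties(4)[OF part(1) orth(1)] orth_properties(4)[OF part(2) orth(3)]
    by (simp_all only: orth(2,4)[symmetric])
  ultimately have size: "sum_list ?\<epsilon> + w = sum_list ?\<delta>
      + (if wt_label (part1 \<pi>) = w then w else 0) + (if wt_label (part0 \<pi>) = w then w else 0)"
    using w_def unfolding total_def by linarith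
  have low: "first_part ?\<delta> = w \<and> ?\<epsilon> = tl ?\<delta>"
    if "wt_label (part1 \<pi>) \<noteq> w" "wt_label (part0 \<pi>) \<noteq> w"
  proof -
    have "sum_list ?\<epsilon> < sum_list ?\<delta>" using size that orth(1) by simp
    then have "?\<epsilon> = tl ?\<delta>" by (rule \<epsilon>_less)
    then show ?thesis using size that sum_list_tl[of ?\<delta>] by simp
  qed
  have "wt_label (part1 \<pi>) = w \<or> wt_label (part0 \<pi>) = w \<or> first_part ?\<delta> = w"
    using low by blast
  then have w: "wt_triple \<pi> = w"
    using first orth(1,3) unfolding wt_triple_eq_max by linarith
  have "?\<epsilon> = part_delta (lozenge_formula \<pi>)"
  proof (cases "wt_label (part1 \<pi>) = w \<and> wt_label (part0 \<pi>) = w")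
    case True
    then have "sum_list ?\<epsilon> = sum_list ?\<delta> + w" using size by simp
    then have "?\<epsilon> = add_top_row w ?\<delta>"
      using \<epsilon>_eq \<epsilon>_more by (cases "w = 0") (simp_all add: add_top_row_def)
    then show ?thesis using True w by (simp add: lozenge_formula_def Let_def)
  next
    case notboth: False
    show ?thesis
    proof (cases "wt_label (part1 \<pi>) \<noteq> w \<and> wt_label (part0 \<pi>) \<noteq> w")
      case True
      then show ?thesis using low orth w by (simp add: lozenge_formula_def Let_def)
    next
      case False
      then have one: "(wt_label (part1 \<pi>) = w) \<noteq> (wt_label (part0 \<pi>) = w)"
        using notboth by blast
      then have "sum_list ?\<epsilon> = sum_list ?\<delta>" using size by (simp split: if_splits)
      then have "?\<epsilon> = ?\<delta>" by (rule \<epsilon>_eq)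
      moreover have "part_delta (lozenge_formula \<pi>) = ?\<delta>"
        using one unfolding lozenge_formula_def Let_def w
        by (cases "wt_label (part1 \<pi>) = w") simp_all
      ultimately show ?thesis by simp
    qed
  qed
  then show ?thesis
    using orth w by (intro partition_triple.expand) (simp add: lozenge_formula_def Let_def)
qed

theorem theoremB:
  fixes \<beta> :: pos_cone and \<pi> :: partition_triple
  assumes "\<pi> \<in> root_partitions \<beta>"
  shows "part1 (lozenge \<beta> \<pi>) = orth (wt_triple \<pi>) (part0 \<pi>)
    \<and> part0 (lozenge \<beta> \<pi>) = orth (wt_triple \<pi>) (part1 \<pi>)
    \<and> part_delta (lozenge \<beta> \<pi>) =
        (if wt_triple \<pi> = wt_label (part0 \<pi>) \<and> wt_triple \<pi> = wt_label (part1 \<pi>)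
         then add_top_row (wt_triple \<pi>) (part_delta \<pi>)
         else if wt_triple \<pi> > wt_label (part0 \<pi>) \<and> wt_triple \<pi> > wt_label (part1 \<pi>)
         then tl (part_delta \<pi>)
         else part_delta \<pi>)"
proof -
  have "lozenge \<beta> \<pi> = lozenge_formula \<pi>"
    unfolding lozenge_def
    using lozenge_formula_affine_MV[OF assms] affine_MV_imp_lozenge_formula[OF assms]
    by (intro the_equality) blast+
  then show ?thesis by (simp add: lozenge_formula_def Let_def)
qed

end
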